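(* If $\mathfrak{a}=\omega_1$, then the Banach space $\ell_\infty/c_0$ is not $c_0(\omega_1)$-automorphic and is not $c_0(\omega_1)$-extensible.
   Context: All Banach spaces are over $\mathbb{R}$; operators are bounded and linear; $\ell_\infty=\ell_\infty(\mathbb{N})$, $c_0=c_0(\mathbb{N})$, and $\ell_\infty/c_0$ carries the quotient norm. An isomorphism is a linear homeomorphism. The density $dens(X)$ of a Banach space $X$ is the least cardinality of a dense subset. $\mathfrak{a}$ denotes the smallest infinite cardinality of a maximal family of infinite subsets of $\mathbb{N}$ whose pairwise intersections are finite (a maximal almost disjoint family). Let $X,Y$ be Banach spaces. $X$ is $Y$-extensible if for every (closed) subspace $Z\subseteq X$ isomorphic to $Y$ every operator $T:Z\to X$ extends to an operator $\tilde T:X\to X$. $X$ is $Y$-automorphic if for all subspaces $Z,Z'\subseteq X$ which are isomorphic to $Y$ and have the same codimension (i.e., $dens(X/Z)=dens(X/Z')$), every isomorphism between $Z$ and $Z'$ extends to an automorphism of $X$ (an isomorphism of $X$ onto $X$). *)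

theory Defs
  imports "HOL-Analysis.Analysis"
begin

unbundle cardinal_syntax

section \<open>Least cardinalities, \<open>\<omega>\<^sub>1\<close> and the cardinal \<open>\<aa>\<close>\<close>

text \<open>
  Cardinals are represented by wellorders, as in the library, and are compared with \<open>=o\<close>.
  The value of \<open>least_card P\<close> is meaningful only if some set satisfies \<open>P\<close>.
\<close>

definition least_card :: "('a set \<Rightarrow> bool) \<Rightarrow> 'a rel" where
  "least_card P = |SOME A. P A \<and> (\<forall>B. P B \<longrightarrow> |A| \<le>o |B| )|"

lemma least_card_attained:
  assumes "P B"
  obtains A where "P A" "least_card P = |A|" "\<And>C. P C \<Longrightarrow> |A| \<le>o |C|"
proof -
  have "\<exists>r \<in> card_of ` Collect P. \<forall>r' \<in> card_of ` Collect P. r \<le>o r'"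
    using assms by (intro exists_minim_Card_order) (auto simp: card_of_Card_order)
  then have "\<exists>A. P A \<and> (\<forall>B. P B \<longrightarrow> |A| \<le>o |B| )"
    by auto
  then have "P (SOME A. P A \<and> (\<forall>B. P B \<longrightarrow> |A| \<le>o |B| )) \<and>
      (\<forall>C. P C \<longrightarrow> |SOME A. P A \<and> (\<forall>B. P B \<longrightarrow> |A| \<le>o |B| )| \<le>o |C| )"
    by (rule someI_ex)
  then show ?thesis
    using that unfolding least_card_def by blast
qed

abbreviation aleph1 :: "nat set rel" where
  "aleph1 \<equiv> cardSuc natLeq"

typedef omega1 = "Field aleph1"
proof -
  have "infinite (Field aleph1)"
    using cardSuc_finite[OF natLeq_Card_order] by (simp add: Field_natLeq)
  then show ?thesis
    by (metis finite.emptyI ex_in_conv)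
qed

lemma card_of_omega1: "|UNIV :: omega1 set| =o aleph1"
proof -
  have "bij_betw Rep_omega1 UNIV (Field aleph1)"
    by (auto simp: bij_betw_def inj_on_def Rep_omega1_inject type_definition.Rep_range
        [OF type_definition_omega1])
  then have "|UNIV :: omega1 set| =o |Field aleph1|"
    by (auto simp: card_of_ordIso[symmetric])
  also have "|Field aleph1| =o aleph1"
    by (rule card_of_Field_ordIso[OF cardSuc_Card_order[OF natLeq_Card_order]])
  finally show ?thesis .
qed

definition almost_disjoint :: "nat set set \<Rightarrow> bool" where
  "almost_disjoint \<A> \<longleftrightarrow> (\<forall>A\<in>\<A>. infinite A) \<and> pairwise (\<lambda>A B. finite (A \<inter> B)) \<A>"

definition maximal_almost_disjoint :: "nat set set \<Rightarrow> bool" where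
  "maximal_almost_disjoint \<A> \<longleftrightarrow>
     almost_disjoint \<A> \<and> (\<forall>\<B>. almost_disjoint \<B> \<and> \<A> \<subseteq> \<B> \<longrightarrow> \<B> = \<A>)"

definition almost_disjointness_number :: "nat set rel" where
  "almost_disjointness_number = least_card (\<lambda>\<A>. infinite \<A> \<and> maximal_almost_disjoint \<A>)"

lemma infinite_maximal_almost_disjoint_exists:
  "\<exists>\<A>. infinite \<A> \<and> maximal_almost_disjoint \<A>"
proof -
  define row where "row = (\<lambda>n. range (\<lambda>k. prod_encode (n, k)))"
  have row_inf: "infinite (row n)" for n
    unfolding row_def by (intro range_inj_infinite injI) (simp add: prod_encode_eq)
  have row_disj: "row m \<inter> row n = {}" if "m \<noteq> n" for m n
    using that by (auto simp: row_def prod_encode_eq)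
  have "inj row"
    by (metis injI row_disj row_inf inf.idem finite.emptyI)
  then have F_inf: "infinite (range row)"
    by (rule range_inj_infinite)
  have F_ad: "almost_disjoint (range row)"
    unfolding almost_disjoint_def pairwise_def using row_inf row_disj
    by (metis finite.emptyI imageE)
  let ?S = "{\<A>. almost_disjoint \<A> \<and> range row \<subseteq> \<A>}"
  have "\<exists>M\<in>?S. \<forall>X\<in>?S. M \<subseteq> X \<longrightarrow> X = M"
  proof (rule subset_Zorn_nonempty)
    show "?S \<noteq> {}"
      using F_ad by auto
  next
    fix \<C> assume ne: "\<C> \<noteq> {}" and ch: "subset.chain ?S \<C>"
    have "infinite A" if "A \<in> \<Union>\<C>" for A
      using that ch by (auto simp: subset.chain_def almost_disjoint_def)
    moreover have "finite (A \<inter> B)" if AB: "A \<in> \<Union>\<C>" "B \<in> \<Union>\<C>" "A \<noteq> B" for A B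
    proof -
      obtain X Y where "X \<in> \<C>" "Y \<in> \<C>" "A \<in> X" "B \<in> Y"
        using AB by auto
      moreover have "X \<subseteq> Y \<or> Y \<subseteq> X"
        using ch \<open>X \<in> \<C>\<close> \<open>Y \<in> \<C>\<close> by (auto simp: subset_chain_def)
      ultimately obtain Z where "Z \<in> \<C>" "A \<in> Z" "B \<in> Z"
        by blast
      moreover have "almost_disjoint Z"
        using ch \<open>Z \<in> \<C>\<close> by (auto simp: subset_chain_def)
      ultimately show ?thesis
        using \<open>A \<noteq> B\<close> by (auto simp: almost_disjoint_def pairwise_def)
    qed
    moreover have "range row \<subseteq> \<Union>\<C>"
      using ne ch by (fastforce simp: subset_chain_def)
    ultimately show "\<Union>\<C> \<in> ?S"
      by (auto simp: almost_disjoint_def pairwise_def)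
  qed
  then obtain M where M: "almost_disjoint M" "range row \<subseteq> M"
      "\<And>X. almost_disjoint X \<Longrightarrow> range row \<subseteq> X \<Longrightarrow> M \<subseteq> X \<Longrightarrow> X = M"
    by auto
  have "infinite M"
    using F_inf M(2) finite_subset by blast
  moreover have "maximal_almost_disjoint M"
    unfolding maximal_almost_disjoint_def using M by (meson order_trans)
  ultimately show ?thesis
    by blast
qed


section \<open>Quotients by closed subspaces\<close>

definition quotient_norm :: "'a::real_normed_vector set \<Rightarrow> 'a \<Rightarrow> real" where
  "quotient_norm Z x = (INF z\<in>Z. norm (x - z))"

lemma quotient_norm_eq_infdist: "Z \<noteq> {} \<Longrightarrow> quotient_norm Z x = infdist x Z"
  by (simp add: quotient_norm_def infdist_def dist_norm)

lemma quotient_norm_le: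
  assumes "subspace Z" "x - y \<in> Z"
  shows "quotient_norm Z x \<le> norm y"
proof -
  have "quotient_norm Z x = infdist x Z"
    using assms(2) by (intro quotient_norm_eq_infdist) auto
  also have "\<dots> \<le> dist x (x - y)"
    using assms(2) by (rule infdist_le)
  finally show ?thesis
    by (simp add: dist_norm)
qed

lemma quotient_norm_approx:
  assumes "subspace Z" "quotient_norm Z x < r"
  obtains y where "x - y \<in> Z" "norm y < r"
proof -
  have ne: "Z \<noteq> {}"
    using assms(1) subspace_0 by auto
  then have "\<exists>z\<in>Z. norm (x - z) < r"
    using assms(2) unfolding quotient_norm_def
    by (subst (asm) cINF_less_iff) (auto intro: bdd_belowI[of _ 0])
  then obtain z where "z \<in> Z" "norm (x - z) < r"
    by blast
  then show thesis
    by (intro that[of "x - z"]) auto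
qed

lemma quotient_norm_cong:
  assumes "subspace Z" "x - y \<in> Z"
  shows "quotient_norm Z x = quotient_norm Z y"
proof -
  have *: "quotient_norm Z u \<le> quotient_norm Z v" if "u - v \<in> Z" for u v
  proof (rule ccontr)
    assume "\<not> quotient_norm Z u \<le> quotient_norm Z v"
    then have "quotient_norm Z v < quotient_norm Z u"
      by simp
    then obtain w where w: "v - w \<in> Z" "norm w < quotient_norm Z u"
      by (rule quotient_norm_approx[OF assms(1)])
    then have "u - w \<in> Z"
      using subspace_add[OF assms(1) that w(1)] by simp
    then show False
      using quotient_norm_le[OF assms(1), of u w] w(2) by simp
  qed
  have "y - x \<in> Z"
    using subspace_neg[OF assms(1,2)] by simp
  then show ?thesis
    by (intro antisym *[OF assms(2)] *)
qed

lemma quotient_norm_eq_0_iff: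
  assumes "subspace Z" "closed Z"
  shows "quotient_norm Z x = 0 \<longleftrightarrow> x \<in> Z"
proof -
  have ne: "Z \<noteq> {}"
    using assms(1) subspace_0 by auto
  then show ?thesis
    using in_closed_iff_infdist_zero[OF assms(2) ne] by (simp add: quotient_norm_eq_infdist)
qed

lemma quotient_norm_triangle:
  assumes "subspace Z"
  shows "quotient_norm Z (x + y) \<le> quotient_norm Z x + quotient_norm Z y"
proof (rule field_le_epsilon)
  fix e :: real assume "e > 0"
  obtain u where u: "x - u \<in> Z" "norm u < quotient_norm Z x + e / 2"
    using quotient_norm_approx[OF assms, of x "quotient_norm Z x + e / 2"] \<open>e > 0\<close> by auto
  obtain v where v: "y - v \<in> Z" "norm v < quotient_norm Z y + e / 2"
    using quotient_norm_approx[OF assms, of y "quotient_norm Z y + e / 2"] \<open>e > 0\<close> by auto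
  have "x + y - (u + v) \<in> Z"
    using subspace_add[OF assms u(1) v(1)] by (simp add: algebra_simps)
  then have "quotient_norm Z (x + y) \<le> norm (u + v)"
    by (rule quotient_norm_le[OF assms])
  also have "\<dots> \<le> norm u + norm v"
    by (rule norm_triangle_ineq)
  finally show "quotient_norm Z (x + y) \<le> quotient_norm Z x + quotient_norm Z y + e"
    using u v by simp
qed

lemma quotient_norm_scaleR:
  assumes "subspace Z"
  shows "quotient_norm Z (c *\<^sub>R x) = \<bar>c\<bar> * quotient_norm Z x"
proof -
  have le: "quotient_norm Z (c *\<^sub>R x) \<le> \<bar>c\<bar> * quotient_norm Z x" if "c \<noteq> 0" for c x
  proof (rule ccontr)
    assume "\<not> quotient_norm Z (c *\<^sub>R x) \<le> \<bar>c\<bar> * quotient_norm Z x"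
    then have "quotient_norm Z x < quotient_norm Z (c *\<^sub>R x) / \<bar>c\<bar>"
      using that by (simp add: field_simps)
    then obtain y where y: "x - y \<in> Z" "norm y < quotient_norm Z (c *\<^sub>R x) / \<bar>c\<bar>"
      using quotient_norm_approx[OF assms] by blast
    have "c *\<^sub>R x - c *\<^sub>R y \<in> Z"
      using subspace_scale[OF assms y(1), of c] by (simp add: algebra_simps)
    then have "quotient_norm Z (c *\<^sub>R x) \<le> norm (c *\<^sub>R y)"
      by (rule quotient_norm_le[OF assms])
    then show False
      using y(2) that by (simp add: field_simps)
  qed
  show ?thesis
  proof (cases "c = 0")
    case True
    have "Z \<noteq> {}" "0 \<in> Z"
      using subspace_0[OF assms] by auto
    then show ?thesis
      using True by (simp add: quotient_norm_eq_infdist)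
  next
    case False
    have "quotient_norm Z x = quotient_norm Z (inverse c *\<^sub>R (c *\<^sub>R x))"
      using False by simp
    also have "\<dots> \<le> \<bar>inverse c\<bar> * quotient_norm Z (c *\<^sub>R x)"
      using False by (intro le) simp
    finally have "\<bar>c\<bar> * quotient_norm Z x \<le> quotient_norm Z (c *\<^sub>R x)"
      using False by (simp add: field_simps)
    then show ?thesis
      using le[OF False, of x] by simp
  qed
qed

text \<open>Completeness passes to quotients; \<open>q\<close> stands for the quotient map.\<close>

lemma Cauchy_convergent_quotient:
  fixes q :: "'a::real_normed_vector \<Rightarrow> 'b::real_normed_vector" and X :: "nat \<Rightarrow> 'b"
  assumes complete: "\<And>f :: nat \<Rightarrow> 'a. Cauchy f \<Longrightarrow> convergent f"
    and q: "linear q" "\<And>x. norm (q x) \<le> norm x"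
    and lift: "\<And>u r. norm u < r \<Longrightarrow> \<exists>x. q x = u \<and> norm x < r"
    and X: "Cauchy X"
  shows "convergent X"
proof -
  have blq: "bounded_linear q"
    by (rule bounded_linear_intro[where K = 1])
       (use q in \<open>auto simp: linear_add linear_scale\<close>)
  have "\<exists>N. \<forall>m\<ge>N. \<forall>n\<ge>N. norm (X m - X n) < (1/2) ^ k" for k :: nat
    using CauchyD[OF X, of "(1/2) ^ k"] by simp
  then obtain N where N: "\<And>k m n. m \<ge> N k \<Longrightarrow> n \<ge> N k \<Longrightarrow> norm (X m - X n) < (1/2) ^ k"
    by metis
  define r where "r = rec_nat (N 0) (\<lambda>k a. max (Suc a) (N (Suc k)))"
  have r_Suc: "r (Suc k) = max (Suc (r k)) (N (Suc k))" for k
    by (simp add: r_def)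
  have mono: "strict_mono r"
    by (rule strict_monoI_Suc) (simp add: r_Suc)
  have rN: "r k \<ge> N k" for k
    by (cases k) (auto simp: r_def)
  have "\<exists>x. q x = X (r (Suc k)) - X (r k) \<and> norm x < (1/2) ^ k" for k
  proof (rule lift)
    have "r (Suc k) \<ge> N k"
      using rN[of k] r_Suc[of k] by simp
    then show "norm (X (r (Suc k)) - X (r k)) < (1/2) ^ k"
      using rN by (intro N) auto
  qed
  then obtain y where y: "\<And>k. q (y k) = X (r (Suc k)) - X (r k)" "\<And>k. norm (y k) < (1/2) ^ k"
    by metis
  have "summable (\<lambda>k. norm (y k))"
    by (rule summable_comparison_test[OF _ summable_geometric[of "1/2 :: real"]])
       (use y(2) in \<open>auto intro: less_imp_le\<close>)
  have "Cauchy (\<lambda>n. \<Sum>k<n. y k)"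
  proof (rule CauchyI')
    fix e :: real assume "e > 0"
    then obtain M where M: "\<And>m n. m \<ge> M \<Longrightarrow> norm (\<Sum>k=m..<n. norm (y k)) < e"
      using \<open>summable (\<lambda>k. norm (y k))\<close> unfolding summable_Cauchy by blast
    have "dist (\<Sum>k<m. y k) (\<Sum>k<n. y k) < e" if "m \<ge> M" "n > m" for m n
    proof -
      have "(\<Sum>k<n. y k) - (\<Sum>k<m. y k) = (\<Sum>k=m..<n. y k)"
        using sum_diff_nat_ivl[of 0 m n y] that by (simp add: atLeast0LessThan)
      moreover have "norm (\<Sum>k=m..<n. y k) \<le> (\<Sum>k=m..<n. norm (y k))"
        by (rule norm_sum)
      ultimately show ?thesis
        using M[OF that(1), of n] by (simp add: dist_norm norm_minus_commute[of "sum y {..<m}"])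
    qed
    then show "\<exists>M. \<forall>m\<ge>M. \<forall>n>m. dist (\<Sum>k<m. y k) (\<Sum>k<n. y k) < e"
      by blast
  qed
  then obtain s where "(\<lambda>n. \<Sum>k<n. y k) \<longlonglongrightarrow> s"
    using complete by (auto simp: convergent_def)
  then have "(\<lambda>n. q (\<Sum>k<n. y k)) \<longlonglongrightarrow> q s"
    by (rule bounded_linear.tendsto[OF blq])
  moreover have "q (\<Sum>k<n. y k) = X (r n) - X (r 0)" for n
    by (simp add: linear_sum[OF q(1)] y(1) sum_lessThan_telescope[of "\<lambda>k. X (r k)"])
  ultimately have "(\<lambda>n. X (r n) - X (r 0) + X (r 0)) \<longlonglongrightarrow> q s + X (r 0)"
    by (intro tendsto_add tendsto_const) simp
  then have "(X \<circ> r) \<longlonglongrightarrow> q s + X (r 0)"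
    by (simp add: o_def)
  then show ?thesis
    using Cauchy_converges_subseq[OF X mono] by (auto simp: convergent_def)
qed

text \<open>
  The density of \<open>X/Z\<close>: its points are the cosets \<open>x + Z\<close>, and the distance of
  \<open>x + Z\<close> and \<open>y + Z\<close> is \<open>quotient_norm Z (x - y)\<close>.
\<close>

definition coset :: "'a::real_normed_vector set \<Rightarrow> 'a \<Rightarrow> 'a set" where
  "coset Z x = (\<lambda>z. x + z) ` Z"

definition dense_in_quotient :: "'a::real_normed_vector set \<Rightarrow> 'a set set \<Rightarrow> bool" where
  "dense_in_quotient Z D \<longleftrightarrow> D \<subseteq> range (coset Z) \<and>
     (\<forall>x. \<forall>e>0. \<exists>y. coset Z y \<in> D \<and> quotient_norm Z (x - y) < e)"

definition dens_quotient :: "'a::real_normed_vector set \<Rightarrow> 'a set rel" where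
  "dens_quotient Z = least_card (dense_in_quotient Z)"

lemma dense_in_quotient_range: "subspace Z \<Longrightarrow> dense_in_quotient Z (range (coset Z))"
  using subspace_0[of Z] quotient_norm_le[of Z 0 0]
  unfolding dense_in_quotient_def by (metis diff_self norm_zero order_le_less_trans rangeI subset_refl)


section \<open>The Banach space \<open>\<ell>\<^sub>\<infinity>/c\<^sub>0\<close>\<close>

text \<open>
  Since the topology of \<^typ>\<open>nat\<close> is discrete, the type \<open>nat \<Rightarrow>\<^sub>C real\<close> of bounded
  continuous functions with the supremum norm is \<open>\<ell>\<^sub>\<infinity>\<close>.
\<close>

type_synonym linfty = "nat \<Rightarrow>\<^sub>C real"

lemma linfty_Cauchy_convergent:
  fixes f :: "nat \<Rightarrow> linfty"
  assumes "Cauchy f"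
  shows "convergent f"
proof -
  obtain g where "uniform_limit UNIV f g sequentially"
    using assms uniformly_convergent_eq_cauchy[of "\<lambda>_. True" f]
    unfolding Cauchy_def uniform_limit_sequentially_iff
    by (metis dist_fun_lt_imp_dist_val_lt)
  then obtain l where "f \<longlonglongrightarrow> l"
    using uniform_limit_bcontfunE sequentially_bot by metis
  then show ?thesis
    by (rule convergentI)
qed

definition null_sequences :: "linfty set" where
  "null_sequences = {x. apply_bcontfun x \<longlonglongrightarrow> 0}"

lemma subspace_null_sequences: "subspace null_sequences"
  unfolding subspace_def null_sequences_def
  by (auto intro!: tendsto_eq_intros)

lemma closed_null_sequences: "closed null_sequences"
proof (unfold closed_sequential_limits, intro allI impI, elim conjE)
  fix f :: "nat \<Rightarrow> linfty" and l
  assume f: "\<forall>n. f n \<in> null_sequences" and "f \<longlonglongrightarrow> l"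
  then have "uniform_limit UNIV f l sequentially"
    by (intro tendsto_bcontfun_uniform_limit)
  then have "apply_bcontfun l \<longlonglongrightarrow> 0"
    by (rule swap_uniform_limit'[rotated 2, where g = "\<lambda>_. 0"])
       (use f in \<open>auto simp: null_sequences_def\<close>)
  then show "l \<in> null_sequences"
    by (simp add: null_sequences_def)
qed

lemma null_sequences_diff_equiv: "equivp (\<lambda>x y. x - y \<in> null_sequences)"
proof (rule equivpI)
  show "reflp (\<lambda>x y. x - y \<in> null_sequences)"
    using subspace_0[OF subspace_null_sequences] by (auto intro: reflpI)
  show "symp (\<lambda>x y. x - y \<in> null_sequences)"
    using subspace_neg[OF subspace_null_sequences] by (intro sympI) force
  show "transp (\<lambda>x y. x - y \<in> null_sequences)"
    using subspace_add[OF subspace_null_sequences] by (intro transpI) force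
qed

quotient_type linfty_mod_c0 = linfty / "\<lambda>x y. x - y \<in> null_sequences"
  by (rule null_sequences_diff_equiv)

instantiation linfty_mod_c0 :: real_normed_vector
begin

lift_definition zero_linfty_mod_c0 :: linfty_mod_c0 is 0 .

lift_definition plus_linfty_mod_c0 :: "linfty_mod_c0 \<Rightarrow> linfty_mod_c0 \<Rightarrow> linfty_mod_c0" is "(+)"
  using subspace_add[OF subspace_null_sequences] by (metis add_diff_add)

lift_definition uminus_linfty_mod_c0 :: "linfty_mod_c0 \<Rightarrow> linfty_mod_c0" is uminus
  using subspace_neg[OF subspace_null_sequences] by (metis minus_diff_minus)

lift_definition minus_linfty_mod_c0 :: "linfty_mod_c0 \<Rightarrow> linfty_mod_c0 \<Rightarrow> linfty_mod_c0" is "(-)"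
proof -
  fix a b c d :: linfty
  assume "a - b \<in> null_sequences" "c - d \<in> null_sequences"
  then have "(a - b) - (c - d) \<in> null_sequences"
    by (rule subspace_diff[OF subspace_null_sequences])
  then show "(a - c) - (b - d) \<in> null_sequences"
    by (simp add: algebra_simps)
qed

lift_definition scaleR_linfty_mod_c0 :: "real \<Rightarrow> linfty_mod_c0 \<Rightarrow> linfty_mod_c0" is scaleR
  using subspace_scale[OF subspace_null_sequences] by (metis scaleR_diff_right)

lift_definition norm_linfty_mod_c0 :: "linfty_mod_c0 \<Rightarrow> real" is "quotient_norm null_sequences"
  by (rule quotient_norm_cong[OF subspace_null_sequences])

definition dist_linfty_mod_c0 :: "linfty_mod_c0 \<Rightarrow> linfty_mod_c0 \<Rightarrow> real" where
  "dist_linfty_mod_c0 x y = norm (x - y)"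

definition sgn_linfty_mod_c0 :: "linfty_mod_c0 \<Rightarrow> linfty_mod_c0" where
  "sgn_linfty_mod_c0 x = inverse (norm x) *\<^sub>R x"

definition uniformity_linfty_mod_c0 :: "(linfty_mod_c0 \<times> linfty_mod_c0) filter" where
  "uniformity_linfty_mod_c0 = (INF e\<in>{0<..}. principal {(x, y). dist x y < e})"

definition open_linfty_mod_c0 :: "linfty_mod_c0 set \<Rightarrow> bool" where
  "open_linfty_mod_c0 U \<longleftrightarrow> (\<forall>x\<in>U. \<forall>\<^sub>F (x', y) in uniformity. x' = x \<longrightarrow> y \<in> U)"

instance
proof
  have 0: "0 \<in> null_sequences"
    by (rule subspace_0[OF subspace_null_sequences])
  fix x y z :: linfty_mod_c0 and a b :: real
  show "x + y + z = x + (y + z)" by transfer (simp add: 0 algebra_simps)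
  show "x + y = y + x" by transfer (simp add: 0 algebra_simps)
  show "0 + x = x" by transfer (simp add: 0)
  show "- x + x = 0" by transfer (simp add: 0)
  show "x - y = x + - y" by transfer (simp add: 0)
  show "a *\<^sub>R (x + y) = a *\<^sub>R x + a *\<^sub>R y" by transfer (simp add: 0 algebra_simps)
  show "(a + b) *\<^sub>R x = a *\<^sub>R x + b *\<^sub>R x" by transfer (simp add: 0 algebra_simps)
  show "a *\<^sub>R b *\<^sub>R x = (a * b) *\<^sub>R x" by transfer (simp add: 0)
  show "1 *\<^sub>R x = x" by transfer (simp add: 0)
  show "norm x = 0 \<longleftrightarrow> x = 0"
    by transfer (simp add: quotient_norm_eq_0_iff subspace_null_sequences closed_null_sequences)
  show "norm (x + y) \<le> norm x + norm y"
    by transfer (rule quotient_norm_triangle[OF subspace_null_sequences])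
  show "norm (a *\<^sub>R x) = \<bar>a\<bar> * norm x"
    by transfer (rule quotient_norm_scaleR[OF subspace_null_sequences])
qed (rule dist_linfty_mod_c0_def sgn_linfty_mod_c0_def uniformity_linfty_mod_c0_def
      open_linfty_mod_c0_def)+

end

instance linfty_mod_c0 :: banach
proof
  fix X :: "nat \<Rightarrow> linfty_mod_c0"
  assume "Cauchy X"
  then show "convergent X"
  proof (rule Cauchy_convergent_quotient[where q = abs_linfty_mod_c0, rotated 4])
    show "convergent f" if "Cauchy f" for f :: "nat \<Rightarrow> linfty"
      using that by (rule linfty_Cauchy_convergent)
    show "linear abs_linfty_mod_c0"
      by (rule linearI) (simp_all add: plus_linfty_mod_c0.abs_eq scaleR_linfty_mod_c0.abs_eq)
    show "norm (abs_linfty_mod_c0 x) \<le> norm x" for x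
      by (simp add: norm_linfty_mod_c0.abs_eq quotient_norm_le[OF subspace_null_sequences]
          subspace_0[OF subspace_null_sequences])
    show "\<exists>x. abs_linfty_mod_c0 x = u \<and> norm x < r" if "norm u < r" for u r
      using that
    proof (transfer, goal_cases)
      case (1 u r)
      then obtain y where y: "u - y \<in> null_sequences" "norm y < r"
        using quotient_norm_approx[OF subspace_null_sequences] by blast
      then have "y - u \<in> null_sequences"
        using subspace_neg[OF subspace_null_sequences y(1)] by simp
      then show ?case
        using y(2) by blast
    qed
  qed
qed


section \<open>The Banach spaces \<open>c\<^sub>0(\<Gamma>)\<close>\<close>

text \<open>The index set \<open>\<Gamma>\<close> is the universe of the type \<open>'i\<close>.\<close>

typedef 'i c0 = "{f :: 'i \<Rightarrow> real. \<forall>e>0. finite {i. e \<le> \<bar>f i\<bar>}}"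
  morphisms apply_c0 Abs_c0
  by (rule exI[of _ "\<lambda>_. 0"]) simp

setup_lifting type_definition_c0

lemma finite_c0: "0 < e \<Longrightarrow> finite {i. e \<le> \<bar>apply_c0 f i\<bar>}"
  using apply_c0[of f] by simp

lemma bdd_above_c0: "bdd_above (range (\<lambda>i. \<bar>apply_c0 f i\<bar>))"
proof -
  let ?S = "{i. 1 \<le> \<bar>apply_c0 f i\<bar>}"
  have "\<bar>apply_c0 f i\<bar> \<le> 1 + (\<Sum>j\<in>?S. \<bar>apply_c0 f j\<bar>)" for i
  proof (cases "i \<in> ?S")
    case True
    then have "\<bar>apply_c0 f i\<bar> \<le> (\<Sum>j\<in>?S. \<bar>apply_c0 f j\<bar>)"
      by (intro member_le_sum) (auto simp: finite_c0)
    then show ?thesis by simp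
  next
    case False
    moreover have "0 \<le> (\<Sum>j\<in>?S. \<bar>apply_c0 f j\<bar>)"
      by (rule sum_nonneg) simp
    ultimately show ?thesis
      unfolding mem_Collect_eq by linarith
  qed
  then show ?thesis
    by (auto intro!: bdd_aboveI)
qed

instantiation c0 :: (type) real_normed_vector
begin

lift_definition zero_c0 :: "'a c0" is "\<lambda>_. 0" by simp

lift_definition plus_c0 :: "'a c0 \<Rightarrow> 'a c0 \<Rightarrow> 'a c0" is "\<lambda>f g i. f i + g i"
proof -
  fix f g :: "'a \<Rightarrow> real" and e :: real
  assume f: "\<And>e. e > 0 \<Longrightarrow> finite {i. e \<le> \<bar>f i\<bar>}"
    and g: "\<And>e. e > 0 \<Longrightarrow> finite {i. e \<le> \<bar>g i\<bar>}" and "e > 0"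
  have "{i. e \<le> \<bar>f i + g i\<bar>} \<subseteq> {i. e / 2 \<le> \<bar>f i\<bar>} \<union> {i. e / 2 \<le> \<bar>g i\<bar>}"
    by (auto simp: abs_if split: if_splits)
  moreover have "finite ({i. e / 2 \<le> \<bar>f i\<bar>} \<union> {i. e / 2 \<le> \<bar>g i\<bar>})"
    using f g half_gt_zero[OF \<open>e > 0\<close>] by blast
  ultimately show "finite {i. e \<le> \<bar>f i + g i\<bar>}"
    by (rule finite_subset)
qed

lift_definition uminus_c0 :: "'a c0 \<Rightarrow> 'a c0" is "\<lambda>f i. - f i" by simp

definition minus_c0 :: "'a c0 \<Rightarrow> 'a c0 \<Rightarrow> 'a c0" where
  "minus_c0 f g = f + - g"

lift_definition scaleR_c0 :: "real \<Rightarrow> 'a c0 \<Rightarrow> 'a c0" is "\<lambda>c f i. c * f i"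
proof -
  fix c :: real and f :: "'a \<Rightarrow> real" and e :: real
  assume f: "\<And>e. e > 0 \<Longrightarrow> finite {i. e \<le> \<bar>f i\<bar>}" and "e > 0"
  show "finite {i. e \<le> \<bar>c * f i\<bar>}"
  proof (cases "c = 0")
    case False
    then have "{i. e \<le> \<bar>c * f i\<bar>} = {i. e / \<bar>c\<bar> \<le> \<bar>f i\<bar>}"
      by (auto simp: abs_mult field_simps)
    moreover have "e / \<bar>c\<bar> > 0"
      using \<open>e > 0\<close> False by simp
    ultimately show ?thesis
      using f by metis
  qed (use \<open>e > 0\<close> in simp)
qed

definition norm_c0 :: "'a c0 \<Rightarrow> real" where
  "norm_c0 f = (SUP i. \<bar>apply_c0 f i\<bar>)"

definition dist_c0 :: "'a c0 \<Rightarrow> 'a c0 \<Rightarrow> real" where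
  "dist_c0 f g = norm (f - g)"

definition sgn_c0 :: "'a c0 \<Rightarrow> 'a c0" where
  "sgn_c0 f = inverse (norm f) *\<^sub>R f"

definition uniformity_c0 :: "('a c0 \<times> 'a c0) filter" where
  "uniformity_c0 = (INF e\<in>{0<..}. principal {(x, y). dist x y < e})"

definition open_c0 :: "'a c0 set \<Rightarrow> bool" where
  "open_c0 U \<longleftrightarrow> (\<forall>x\<in>U. \<forall>\<^sub>F (x', y) in uniformity. x' = x \<longrightarrow> y \<in> U)"

lemma abs_apply_c0_le_norm: "\<bar>apply_c0 f i\<bar> \<le> norm f"
  unfolding norm_c0_def by (rule cSUP_upper[OF UNIV_I bdd_above_c0])

lemma norm_c0_le: "(\<And>i. \<bar>apply_c0 f i\<bar> \<le> b) \<Longrightarrow> norm f \<le> b"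
  unfolding norm_c0_def by (rule cSUP_least) auto

instance
proof
  fix f g h :: "'a c0" and a b :: real
  show "f + g + h = f + (g + h)" by transfer (simp add: add.assoc)
  show "f + g = g + f" by transfer (simp add: add.commute)
  show "0 + f = f" by transfer simp
  show "- f + f = 0" by transfer simp
  show "f - g = f + - g" by (rule minus_c0_def)
  show "a *\<^sub>R (f + g) = a *\<^sub>R f + a *\<^sub>R g" by transfer (simp add: distrib_left)
  show "(a + b) *\<^sub>R f = a *\<^sub>R f + b *\<^sub>R f" by transfer (simp add: distrib_right)
  show "a *\<^sub>R b *\<^sub>R f = (a * b) *\<^sub>R f" by transfer (simp add: mult.assoc)
  show "1 *\<^sub>R f = f" by transfer simp
  show "norm f = 0 \<longleftrightarrow> f = 0"
  proof
    assume "norm f = 0"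
    then have "apply_c0 f i = 0" for i
      using abs_apply_c0_le_norm[of f i] by simp
    then show "f = 0"
      by (simp add: apply_c0_inject[symmetric] zero_c0.rep_eq fun_eq_iff)
  qed (simp add: norm_c0_def zero_c0.rep_eq)
  show "norm (f + g) \<le> norm f + norm g"
  proof (rule norm_c0_le)
    fix i
    show "\<bar>apply_c0 (f + g) i\<bar> \<le> norm f + norm g"
      using abs_apply_c0_le_norm[of f i] abs_apply_c0_le_norm[of g i]
      by (simp add: plus_c0.rep_eq)
  qed
  have le: "norm (c *\<^sub>R f) \<le> \<bar>c\<bar> * norm f" for c and f :: "'a c0"
    by (rule norm_c0_le)
       (simp add: scaleR_c0.rep_eq abs_mult mult_left_mono abs_apply_c0_le_norm)
  show "norm (a *\<^sub>R f) = \<bar>a\<bar> * norm f"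
  proof (cases "a = 0")
    case True
    have "\<bar>apply_c0 f undefined\<bar> \<le> norm f" "norm (0 *\<^sub>R f) \<le> 0"
      using abs_apply_c0_le_norm le[of 0 f] by auto
    moreover have "0 \<le> norm (0 *\<^sub>R f)"
      using abs_apply_c0_le_norm[of "0 *\<^sub>R f" undefined] by linarith
    ultimately show ?thesis
      using True by simp
  next
    case False
    have "inverse a *\<^sub>R (a *\<^sub>R f) = f"
      using False by transfer (simp add: fun_eq_iff)
    then have "norm f \<le> \<bar>inverse a\<bar> * norm (a *\<^sub>R f)"
      using le[of "inverse a" "a *\<^sub>R f"] by simp
    then have "\<bar>a\<bar> * norm f \<le> norm (a *\<^sub>R f)"
      using False by (simp add: field_simps)
    then show ?thesis
      using le[of a f] by simp
  qed
qed (rule dist_c0_def sgn_c0_def uniformity_c0_def open_c0_def)+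

end

lemma apply_c0_diff: "apply_c0 (f - g) i = apply_c0 f i - apply_c0 g i"
  unfolding minus_c0_def plus_c0.rep_eq uminus_c0.rep_eq by simp

instance c0 :: (type) banach
proof
  fix X :: "nat \<Rightarrow> 'a c0"
  assume X: "Cauchy X"
  have close: "\<exists>N. \<forall>m\<ge>N. \<forall>n\<ge>N. \<forall>i. \<bar>apply_c0 (X m) i - apply_c0 (X n) i\<bar> < e"
    if e: "e > 0" for e
  proof -
    obtain N where N: "\<And>m n. m \<ge> N \<Longrightarrow> n \<ge> N \<Longrightarrow> norm (X m - X n) < e"
      using CauchyD[OF X e] by blast
    have "\<bar>apply_c0 (X m) i - apply_c0 (X n) i\<bar> < e" if "m \<ge> N" "n \<ge> N" for m n i
      using abs_apply_c0_le_norm[of "X m - X n" i] N[OF that] by (simp add: apply_c0_diff)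
    then show ?thesis
      by blast
  qed
  have Cauchy_apply: "Cauchy (\<lambda>n. apply_c0 (X n) i)" for i
    by (rule CauchyI) (use close in \<open>force\<close>)
  define l where "l i = lim (\<lambda>n. apply_c0 (X n) i)" for i
  have l: "(\<lambda>n. apply_c0 (X n) i) \<longlonglongrightarrow> l i" for i
    unfolding l_def using Cauchy_apply[of i] by (simp add: Cauchy_convergent_iff convergent_LIMSEQ_iff)
  have unif: "\<exists>N. \<forall>n\<ge>N. \<forall>i. \<bar>apply_c0 (X n) i - l i\<bar> \<le> e" if e: "e > 0" for e
  proof -
    obtain N where N: "\<And>m n i. m \<ge> N \<Longrightarrow> n \<ge> N \<Longrightarrow> \<bar>apply_c0 (X m) i - apply_c0 (X n) i\<bar> < e"
      using close[OF e] by blast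
    have "\<bar>apply_c0 (X n) i - l i\<bar> \<le> e" if "n \<ge> N" for n i
    proof (rule tendsto_upperbound)
      show "(\<lambda>m. \<bar>apply_c0 (X n) i - apply_c0 (X m) i\<bar>) \<longlonglongrightarrow> \<bar>apply_c0 (X n) i - l i\<bar>"
        by (intro tendsto_intros l)
      show "\<forall>\<^sub>F m in sequentially. \<bar>apply_c0 (X n) i - apply_c0 (X m) i\<bar> \<le> e"
        using N that by (auto simp: eventually_sequentially intro!: exI[of _ N] less_imp_le)
    qed simp
    then show ?thesis
      by blast
  qed
  have "finite {i. e \<le> \<bar>l i\<bar>}" if e: "e > 0" for e
  proof -
    obtain N where N: "\<And>i. \<bar>apply_c0 (X N) i - l i\<bar> \<le> e / 2"
      using unif[of "e / 2"] e by auto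
    have "e / 2 \<le> \<bar>apply_c0 (X N) i\<bar>" if "e \<le> \<bar>l i\<bar>" for i
      using N[of i] that by linarith
    then have "{i. e \<le> \<bar>l i\<bar>} \<subseteq> {i. e / 2 \<le> \<bar>apply_c0 (X N) i\<bar>}"
      by auto
    then show ?thesis
      using finite_c0[of "e / 2" "X N"] e by (meson finite_subset half_gt_zero)
  qed
  then have L: "apply_c0 (Abs_c0 l) = l"
    by (simp add: Abs_c0_inverse)
  have "X \<longlonglongrightarrow> Abs_c0 l"
  proof (rule LIMSEQ_I)
    fix e :: real assume e: "e > 0"
    then obtain N where "\<forall>n\<ge>N. \<forall>i. \<bar>apply_c0 (X n) i - l i\<bar> \<le> e / 2"
      using unif[OF half_gt_zero] by blast
    then have "norm (X n - Abs_c0 l) \<le> e / 2" if "n \<ge> N" for n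
      using that by (intro norm_c0_le) (simp only: apply_c0_diff L)
    then show "\<exists>N. \<forall>n\<ge>N. norm (X n - Abs_c0 l) < e"
      using e by (intro exI[of _ N]) fastforce
  qed
  then show "convergent X"
    by (auto simp: convergent_def)
qed


section \<open>Extensible and automorphic Banach spaces\<close>

text \<open>
  Maps defined on a subspace are represented by total functions whose values outside the
  subspace are irrelevant.
\<close>

definition linear_on_subspace ::
    "'a::real_vector set \<Rightarrow> ('a \<Rightarrow> 'b::real_vector) \<Rightarrow> bool" where
  "linear_on_subspace Z f \<longleftrightarrow>
     (\<forall>x\<in>Z. \<forall>y\<in>Z. f (x + y) = f x + f y) \<and> (\<forall>c. \<forall>x\<in>Z. f (c *\<^sub>R x) = c *\<^sub>R f x)"

definition operator_on ::
    "'a::real_normed_vector set \<Rightarrow> ('a \<Rightarrow> 'b::real_normed_vector) \<Rightarrow> bool" where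
  "operator_on Z f \<longleftrightarrow> linear_on_subspace Z f \<and> (\<exists>K. \<forall>x\<in>Z. norm (f x) \<le> K * norm x)"

definition isomorphism_between ::
    "'a::real_normed_vector set \<Rightarrow> 'b::real_normed_vector set \<Rightarrow> ('a \<Rightarrow> 'b) \<Rightarrow> bool" where
  "isomorphism_between Z W f \<longleftrightarrow> linear_on_subspace Z f \<and> (\<exists>g. homeomorphism Z W f g)"

definition closed_subspace_isomorphic_to ::
    "'y::banach itself \<Rightarrow> 'x::banach set \<Rightarrow> bool" where
  "closed_subspace_isomorphic_to Y Z \<longleftrightarrow>
     subspace Z \<and> closed Z \<and> (\<exists>f :: 'x \<Rightarrow> 'y. isomorphism_between Z UNIV f)"

definition extensible :: "'x::banach itself \<Rightarrow> 'y::banach itself \<Rightarrow> bool" where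
  "extensible X Y \<longleftrightarrow>
     (\<forall>(Z :: 'x set) (T :: 'x \<Rightarrow> 'x).
        closed_subspace_isomorphic_to Y Z \<and> operator_on Z T \<longrightarrow>
        (\<exists>T' :: 'x \<Rightarrow> 'x. bounded_linear T' \<and> (\<forall>x\<in>Z. T' x = T x)))"

definition automorphic :: "'x::banach itself \<Rightarrow> 'y::banach itself \<Rightarrow> bool" where
  "automorphic X Y \<longleftrightarrow>
     (\<forall>(Z :: 'x set) (Z' :: 'x set) (T :: 'x \<Rightarrow> 'x).
        closed_subspace_isomorphic_to Y Z \<and> closed_subspace_isomorphic_to Y Z' \<and>
        dens_quotient Z =o dens_quotient Z' \<and> isomorphism_between Z Z' T \<longrightarrow>
        (\<exists>T' :: 'x \<Rightarrow> 'x. isomorphism_between UNIV UNIV T' \<and> (\<forall>x\<in>Z. T' x = T x)))"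

end

theory Submission
  imports Defs
begin

text \<open>
  Fix a maximal almost disjoint family \<open>A\<^sub>\<xi>\<close>, \<open>\<xi> < \<omega>\<^sub>1\<close>, and distinct branches \<open>B\<^sub>\<xi>\<close> of the binary
  tree, and let \<open>T\<close> send the class of the indicator of \<open>B\<^sub>\<xi>\<close> to that of \<open>A\<^sub>\<xi>\<close>; this is an isomorphism
  between two copies of \<open>c\<^sub>0(\<omega>\<^sub>1)\<close> of codimension \<open>2\<^sup>\<omega>\<close>. Suppose that it extends to an operator
  \<open>T'\<close> on \<open>\<ell>\<^sub>\<infinity>/c\<^sub>0\<close>. Call \<open>C \<subseteq> \<nat>\<close> positive if it meets infinitely many \<open>A\<^sub>\<xi>\<close> in an infinite set. By
  maximality, decreasing sequences of positive sets have positive pseudo-intersections and a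
  positive set meets uncountably many \<open>A\<^sub>\<xi>\<close>. Hence one can shrink to a positive \<open>C\<close> such that, for
  each of the countably many cylinders of the tree, either no indicator of a subset of the cylinder
  has a large image on a positive subset of \<open>C\<close>, or every positive subset of \<open>C\<close> carries such
  a large image. Uncountably many branches occur in \<open>C\<close>, so there are many disjoint cylinders
  containing infinitely many of them. The second alternative cannot hold for all of these because
  \<open>T'\<close> is bounded; the first one contradicts \<open>T' B\<^sub>\<xi> = A\<^sub>\<xi>\<close> by a Phillips type argument.
\<close>

section \<open>Branches of the binary tree\<close>

definition trunc :: "nat \<Rightarrow> nat set \<Rightarrow> bool list" where
  "trunc n X = map (\<lambda>i. i \<in> X) [0..<n]"

text \<open>\<open>to_nat\<close> codes finite 0-1 strings, so this is the path through the binary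
  tree along the characteristic function of \<open>X\<close>. The paths form the classical almost
  disjoint family of size continuum.\<close>

definition branch :: "nat set \<Rightarrow> nat set" where
  "branch X = range (\<lambda>n. to_nat (trunc n X))"

definition cylinder :: "bool list \<Rightarrow> nat set" where
  "cylinder s = to_nat ` {t. take (length s) t = s}"

lemma length_trunc [simp]: "length (trunc n X) = n"
  by (simp add: trunc_def)

lemma trunc_eq_iff: "trunc n X = trunc n Y \<longleftrightarrow> (\<forall>i<n. i \<in> X \<longleftrightarrow> i \<in> Y)"
  by (auto simp: trunc_def)

lemma take_trunc: "m \<le> n \<Longrightarrow> take m (trunc n X) = trunc m X"
  by (simp add: trunc_def take_map min_def)

lemma infinite_branch: "infinite (branch X)"
proof -
  have "inj (\<lambda>n. to_nat (trunc n X))"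
    by (rule injI) (metis from_nat_to_nat length_trunc)
  then show ?thesis
    unfolding branch_def by (rule range_inj_infinite)
qed

lemma finite_branch_Int:
  assumes "X \<noteq> Y"
  shows "finite (branch X \<inter> branch Y)"
proof -
  obtain i where i: "(i \<in> X) \<noteq> (i \<in> Y)"
    using assms by blast
  have "branch X \<inter> branch Y \<subseteq> (\<lambda>n. to_nat (trunc n X)) ` {..i}"
  proof
    fix k assume "k \<in> branch X \<inter> branch Y"
    then obtain m n where k: "k = to_nat (trunc m X)" "k = to_nat (trunc n Y)"
      unfolding branch_def by blast
    then have eq: "trunc m X = trunc n Y"
      by simp
    then have "m = n"
      by (metis length_trunc)
    then have "m \<le> i"
      using eq i by (auto simp: trunc_eq_iff not_le[symmetric])
    then show "k \<in> (\<lambda>n. to_nat (trunc n X)) ` {..i}"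
      using k by blast
  qed
  then show ?thesis
    by (rule finite_subset) simp
qed

lemma finite_branch_Diff_cylinder: "finite (branch X - cylinder (trunc n X))"
proof (rule finite_subset)
  show "branch X - cylinder (trunc n X) \<subseteq> (\<lambda>m. to_nat (trunc m X)) ` {..<n}"
  proof
    fix k assume k: "k \<in> branch X - cylinder (trunc n X)"
    then obtain m where m: "k = to_nat (trunc m X)"
      unfolding branch_def by blast
    have "m < n"
    proof (rule ccontr)
      assume "\<not> m < n"
      then have "take (length (trunc n X)) (trunc m X) = trunc n X"
        by (simp add: take_trunc)
      then have "k \<in> cylinder (trunc n X)"
        unfolding cylinder_def m by blast
      then show False
        using k by blast
    qed
    then show "k \<in> (\<lambda>m. to_nat (trunc m X)) ` {..<n}"
      using m by blast
  qed
qed simp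

lemma cylinder_disjoint: "length s = length t \<Longrightarrow> s \<noteq> t \<Longrightarrow> cylinder s \<inter> cylinder t = {}"
  by (auto simp: cylinder_def)

text \<open>A level beyond one chosen point of difference for each pair separates all
  members.\<close>

lemma inj_on_trunc:
  assumes "finite P"
  shows "\<exists>n. inj_on (trunc n) P"
proof -
  have "\<exists>i. X \<noteq> Y \<longrightarrow> (i \<in> X) \<noteq> (i \<in> Y)" for X Y :: "nat set"
    by blast
  then obtain d where d: "\<And>X Y :: nat set. X \<noteq> Y \<Longrightarrow> (d X Y \<in> X) \<noteq> (d X Y \<in> Y)"
    by metis
  define n where "n = Suc (Max ((\<lambda>(X, Y). d X Y) ` (P \<times> P)))"
  have "d X Y < n" if "X \<in> P" "Y \<in> P" for X Y
    unfolding n_def less_Suc_eq_le using that assms by (intro Max_ge) auto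
  then have "inj_on (trunc n) P"
    using d by (intro inj_onI) (metis trunc_eq_iff)
  then show ?thesis ..
qed

text \<open>A condensation argument: the members of \<open>Q\<close> with a countable neighbourhood
  in \<open>Q\<close> lie in a countable union of countable sets, so \<open>k\<close> members
  without one exist, and a level that separates them yields the \<open>k\<close> strings.\<close>

lemma uncountable_many_cylinders:
  assumes "uncountable Q"
  obtains n G where "card G = k" "finite G" "\<And>s. s \<in> G \<Longrightarrow> length s = n"
    "\<And>s. s \<in> G \<Longrightarrow> infinite {X \<in> Q. trunc n X = s}"
proof -
  define Q' where "Q' = {X \<in> Q. \<forall>n. uncountable {Y \<in> Q. trunc n Y = trunc n X}}"
  have "Q - Q' \<subseteq> (\<Union>s \<in> {s. countable {Y \<in> Q. trunc (length s) Y = s}}.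
      {Y \<in> Q. trunc (length s) Y = s})"
  proof
    fix X assume "X \<in> Q - Q'"
    then obtain n where "countable {Y \<in> Q. trunc n Y = trunc n X}" "X \<in> Q"
      unfolding Q'_def by blast
    then show "X \<in> (\<Union>s \<in> {s. countable {Y \<in> Q. trunc (length s) Y = s}}.
      {Y \<in> Q. trunc (length s) Y = s})"
      by (intro UN_I[of "trunc n X"]) auto
  qed
  then have "countable (Q - Q')"
    by (rule countable_subset) auto
  then have "infinite Q'"
    using assms uncountable_minus_countable[of Q "Q - Q'"] countable_finite[of Q']
    by (auto simp: Q'_def double_diff)
  then obtain P where P: "P \<subseteq> Q'" "finite P" "card P = k"
    using infinite_arbitrarily_large by blast
  then obtain n where n: "inj_on (trunc n) P"
    using inj_on_trunc by blast
  show ?thesis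
  proof
    show "card (trunc n ` P) = k"
      using card_image[OF n] P by simp
    show "infinite {X \<in> Q. trunc n X = s}" if "s \<in> trunc n ` P" for s
      using that P(1) unfolding Q'_def by (auto dest: countable_finite)
  qed (use P in auto)
qed

section \<open>Positive sets\<close>

definition almost_subset :: "'a set \<Rightarrow> 'a set \<Rightarrow> bool" (infix "\<subseteq>*" 50) where
  "C \<subseteq>* D \<longleftrightarrow> finite (C - D)"

lemma almost_subset_trans: "C \<subseteq>* D \<Longrightarrow> D \<subseteq>* E \<Longrightarrow> C \<subseteq>* E"
  unfolding almost_subset_def by (rule finite_subset[of _ "(C - D) \<union> (D - E)"]) auto

lemma subset_imp_almost_subset: "C \<subseteq> D \<Longrightarrow> C \<subseteq>* D"
  unfolding almost_subset_def by (metis Diff_eq_empty_iff finite.emptyI)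

lemma infinite_almost_subset: "infinite (C \<inter> A) \<Longrightarrow> C \<subseteq>* D \<Longrightarrow> infinite (D \<inter> A)"
  unfolding almost_subset_def
  using finite_subset[of "C \<inter> A" "(D \<inter> A) \<union> (C - D)"] by auto

text \<open>A strictly increasing choice of \<open>g n\<close> in \<open>E n\<close> leaves
  \<open>E n\<close> only at indices below \<open>n\<close>.\<close>

lemma pseudo_intersection:
  fixes E :: "nat \<Rightarrow> nat set"
  assumes "decseq E" "\<And>n. infinite (E n)"
  obtains D where "infinite D" "D \<subseteq> E 0" "\<And>n. D \<subseteq>* E n"
proof -
  have "\<exists>g. \<forall>n. g n \<in> E n \<and> g n < g (Suc n)"
  proof (rule dependent_nat_choice)
    show "\<exists>x. x \<in> E 0"
      using assms(2)[of 0] by (metis ex_in_conv finite.emptyI)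
    show "\<exists>y. y \<in> E (Suc n) \<and> x < y" for x n
      using assms(2)[of "Suc n"] unfolding infinite_nat_iff_unbounded by blast
  qed
  then obtain g where g: "\<And>n. g n \<in> E n" "strict_mono g"
    by (auto simp: strict_mono_Suc_iff)
  show ?thesis
  proof
    show "infinite (range g)"
      using g(2) by (intro range_inj_infinite strict_mono_imp_inj_on)
    show "range g \<subseteq> E 0"
      using g(1) decseqD[OF assms(1), of 0] by auto
    show "range g \<subseteq>* E n" for n
    proof -
      have "range g - E n \<subseteq> g ` {..<n}"
        using g(1) decseqD[OF assms(1), of n] by (force simp: not_less[symmetric])
      then show ?thesis
        unfolding almost_subset_def by (rule finite_subset) simp
    qed
  qed
qed

locale mad_family =
  fixes A :: "'i \<Rightarrow> nat set"
  assumes almost_disjoint: "\<xi> \<noteq> \<eta> \<Longrightarrow> finite (A \<xi> \<inter> A \<eta>)"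
    and maximal: "infinite C \<Longrightarrow> \<exists>\<xi>. infinite (C \<inter> A \<xi>)"
begin

definition hits :: "nat set \<Rightarrow> 'i set" where
  "hits C = {\<xi>. infinite (C \<inter> A \<xi>)}"

text \<open>By maximality these are the sets not almost covered by finitely many
  \<open>A \<xi>\<close>, that is, the complement of the ideal generated by the family and the
  finite sets.\<close>

definition positive :: "nat set \<Rightarrow> bool" where
  "positive C \<longleftrightarrow> infinite (hits C)"

lemma hits_mono: "C \<subseteq>* D \<Longrightarrow> hits C \<subseteq> hits D"
  unfolding hits_def using infinite_almost_subset by blast

lemma positive_mono: "positive C \<Longrightarrow> C \<subseteq>* D \<Longrightarrow> positive D"
  unfolding positive_def using hits_mono finite_subset by blast

lemma positive_imp_infinite: "positive C \<Longrightarrow> infinite C"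
  by (auto simp: positive_def hits_def)

text \<open>Every other member loses only its finite intersections with the removed ones.\<close>

lemma positive_Diff:
  assumes "positive C" "finite F"
  shows "positive (C - (\<Union>\<xi>\<in>F. A \<xi>))"
proof -
  have "hits C - F \<subseteq> hits (C - (\<Union>\<xi>\<in>F. A \<xi>))"
  proof
    fix \<eta> assume \<eta>: "\<eta> \<in> hits C - F"
    have "finite (\<Union>\<xi>\<in>F. A \<xi> \<inter> A \<eta>)"
      using \<eta> assms(2) by (intro finite_UN_I almost_disjoint) auto
    moreover have "C \<inter> A \<eta> \<subseteq> (C - (\<Union>\<xi>\<in>F. A \<xi>)) \<inter> A \<eta> \<union> (\<Union>\<xi>\<in>F. A \<xi> \<inter> A \<eta>)"
      by blast
    ultimately show "\<eta> \<in> hits (C - (\<Union>\<xi>\<in>F. A \<xi>))"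
      using \<eta> finite_subset unfolding hits_def by auto
  qed
  then show ?thesis
    using assms unfolding positive_def by (meson Diff_infinite_finite finite_subset)
qed

text \<open>A mere infinite pseudo-intersection need not be positive, so infinitely many of them are
  found inside different members of the family and glued together.\<close>

lemma positive_pseudo_intersection:
  assumes "decseq C" "\<And>n. positive (C n)"
  obtains D where "positive D" "\<And>n. D \<subseteq>* C n"
proof -
  define \<Xi> where "\<Xi> = {\<xi>. \<exists>D. infinite D \<and> D \<subseteq> A \<xi> \<and> (\<forall>n. D \<subseteq>* C n)}"
  have "infinite \<Xi>"
  proof
    \<comment> \<open>Deleting finitely many members leaves every \<open>C n\<close> infinite. A
      pseudo-intersection of the remainders meets some \<open>A \<xi>\<close> in an infinite set,
      which puts \<open>\<xi>\<close> among the deleted indices.\<close>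
    assume fin: "finite \<Xi>"
    have "decseq (\<lambda>n. C n - (\<Union>\<xi>\<in>\<Xi>. A \<xi>))"
      using assms(1) unfolding decseq_def by blast
    then obtain D where D: "infinite D" "D \<subseteq> C 0 - (\<Union>\<xi>\<in>\<Xi>. A \<xi>)"
        "\<And>n. D \<subseteq>* C n - (\<Union>\<xi>\<in>\<Xi>. A \<xi>)"
      using positive_imp_infinite[OF positive_Diff[OF assms(2) fin]]
      by (rule pseudo_intersection) blast
    obtain \<xi> where \<xi>: "infinite (D \<inter> A \<xi>)"
      using maximal[OF D(1)] by blast
    have "D \<inter> A \<xi> \<subseteq>* C n" for n
      using D(3)[of n] unfolding almost_subset_def by (rule finite_subset[rotated]) blast
    then have "\<xi> \<in> \<Xi>"
      unfolding \<Xi>_def using \<xi> by blast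
    then have "D \<inter> A \<xi> = {}"
      using D(2) by blast
    then show False
      using \<xi> by simp
  qed
  then obtain x :: "nat \<Rightarrow> 'i" where x: "inj x" "range x \<subseteq> \<Xi>"
    using infinite_countable_subset by blast
  have "\<exists>D. infinite D \<and> D \<subseteq> A (x k) \<and> (\<forall>n. D \<subseteq>* C n)" for k
    using x(2) unfolding \<Xi>_def by blast
  then obtain D where D: "\<And>k. infinite (D k)" "\<And>k. D k \<subseteq> A (x k)" "\<And>k n. D k \<subseteq>* C n"
    by metis
  \<comment> \<open>Cutting piece \<open>k\<close> down to \<open>C k\<close> ensures that only the
    pieces with \<open>k < n\<close> stick out of \<open>C n\<close>, each in a finite set.\<close>
  define U where "U = (\<Union>k. D k \<inter> C k)"
  show thesis
  proof
    have "x k \<in> hits U" for k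
    proof -
      have "infinite (D k \<inter> C k)"
        using D(1,3)[of k] unfolding almost_subset_def by (metis Diff_Diff_Int Diff_infinite_finite)
      then have "infinite (U \<inter> A (x k))"
        using D(2)[of k] unfolding U_def by (rule_tac infinite_super[of "D k \<inter> C k"]) auto
      then show ?thesis
        by (simp add: hits_def)
    qed
    then show "positive U"
      unfolding positive_def using range_inj_infinite[OF x(1)] by (meson image_subsetI infinite_super)
    show "U \<subseteq>* C n" for n
    proof -
      have "U - C n \<subseteq> (\<Union>k<n. D k - C n)"
      proof
        fix i assume "i \<in> U - C n"
        then obtain k where "i \<in> D k" "i \<in> C k" "i \<notin> C n"
          unfolding U_def by blast
        moreover from this have "k < n"
          using decseqD[OF assms(1), of n k] by (metis not_less subsetD)
        ultimately show "i \<in> (\<Union>k<n. D k - C n)"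
          by blast
      qed
      moreover have "finite (\<Union>k<n. D k - C n)"
        using D(3) unfolding almost_subset_def by blast
      ultimately show ?thesis
        unfolding almost_subset_def by (rule finite_subset)
    qed
  qed
qed

text \<open>With an enumeration of the hit indices, deleting the first \<open>n\<close> members at
  stage \<open>n\<close> gives decreasing positive sets. A positive pseudo-intersection hits some
  member, but each member that \<open>C\<close> hits is deleted at some stage.\<close>

lemma uncountable_hits:
  assumes "positive C"
  shows "uncountable (hits C)"
proof
  assume "countable (hits C)"
  then have range: "range (from_nat_into (hits C)) = hits C"
    using assms unfolding positive_def by (intro range_from_nat_into) auto
  let ?h = "from_nat_into (hits C)"
  have "decseq (\<lambda>n. C - (\<Union>\<xi>\<in>?h ` {..<n}. A \<xi>))"
    unfolding decseq_def by fastforce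
  then obtain D where D: "positive D" "\<And>n. D \<subseteq>* C - (\<Union>\<xi>\<in>?h ` {..<n}. A \<xi>)"
    using positive_Diff[OF assms] by (rule positive_pseudo_intersection) auto
  obtain \<xi> where \<xi>: "\<xi> \<in> hits D"
    using D(1) unfolding positive_def by (metis ex_in_conv finite.emptyI)
  have "D \<subseteq>* C"
    using D(2)[of 0] by simp
  then have "\<xi> \<in> hits C"
    using \<xi> hits_mono by blast
  then obtain n where "\<xi> = ?h n"
    using range by blast
  moreover have "\<xi> \<in> hits (C - (\<Union>\<xi>\<in>?h ` {..<Suc n}. A \<xi>))"
    using hits_mono[OF D(2)] \<xi> by blast
  ultimately have "infinite ((C - (\<Union>\<xi>\<in>?h ` {..<Suc n}. A \<xi>)) \<inter> A (?h n))"
    by (simp add: hits_def)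
  moreover have "(C - (\<Union>\<xi>\<in>?h ` {..<Suc n}. A \<xi>)) \<inter> A (?h n) = {}"
    by auto
  ultimately show False
    by (metis finite.emptyI)
qed

end

section \<open>Operators that map the branches to the members of the maximal family\<close>

lemma uncountable_UNIV_nat_set: "uncountable (UNIV :: nat set set)"
proof
  assume "countable (UNIV :: nat set set)"
  then have "range (from_nat_into (UNIV :: nat set set)) = Pow UNIV"
    by (simp add: range_from_nat_into)
  then show False
    using Cantors_theorem by blast
qed

text \<open>Converts convergence along \<open>A\<close>, which this filter expresses, into finite
  exceptional sets.\<close>

lemma finite_not_eventually:
  assumes "eventually Q (inf sequentially (principal A))" "D \<subseteq> A"
  shows "finite {m \<in> D. \<not> Q m}"
proof -
  have "finite {m. \<not> (m \<in> A \<longrightarrow> Q m)}"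
    using assms(1) unfolding eventually_inf_principal cofinite_eq_sequentially[symmetric]
    by (simp add: eventually_cofinite)
  then show ?thesis
    by (rule finite_subset[rotated]) (use assms(2) in auto)
qed

text \<open>
  \<open>\<Phi> S\<close> plays the role of a representing sequence of the image of the class of the indicator
  function of \<open>S\<close> under an operator on \<open>\<ell>\<^sub>\<infinity>/c\<^sub>0\<close>.
\<close>

locale branch_operator = mad_family A for A :: "'i \<Rightarrow> nat set" +
  fixes b :: "'i \<Rightarrow> nat set" and \<Phi> :: "nat set \<Rightarrow> nat \<Rightarrow> real" and K :: real
  assumes inj_b: "inj b"
    and bounded_nat: "disjoint_family_on S {..<k :: nat} \<Longrightarrow>
      \<forall>\<^sub>F n in sequentially. (\<Sum>i<k. \<bar>\<Phi> (S i) n\<bar>) \<le> K"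
    and additive: "T \<inter> T' = {} \<Longrightarrow> (\<lambda>n. \<Phi> (T \<union> T') n - \<Phi> T n - \<Phi> T' n) \<longlonglongrightarrow> 0"
    and finite_null: "finite T \<Longrightarrow> \<Phi> T \<longlonglongrightarrow> 0"
    and branch_image: "(\<lambda>n. \<Phi> (branch (b \<xi>)) n - indicator (A \<xi>) n) \<longlonglongrightarrow> 0"
begin

text \<open>An enumeration of \<open>I\<close> reduces this to \<open>bounded_nat\<close>. The
  locale assumption is monomorphic in the index type, whereas sets and strings both serve as indices
  below.\<close>

lemma bounded:
  assumes "finite I" "disjoint_family_on S I"
  shows "\<forall>\<^sub>F n in sequentially. (\<Sum>i\<in>I. \<bar>\<Phi> (S i) n\<bar>) \<le> K"
proof -
  obtain h where h: "bij_betw h {..<card I} I"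
    using ex_bij_betw_nat_finite[OF assms(1)] by (auto simp: atLeast0LessThan)
  have "disjoint_family_on (S \<circ> h) {..<card I}"
    using assms(2) h unfolding disjoint_family_on_def bij_betw_def inj_on_def
    by (metis comp_apply imageI)
  from bounded_nat[OF this] show ?thesis
    by (simp add: sum.reindex_bij_betw[OF h, of "\<lambda>i. \<bar>\<Phi> (S i) _\<bar>"])
qed

text \<open>The first alternative of the dichotomy. The threshold is what is left of the limit value
  1 after two losses of \<open>1/4\<close> in the argument below.\<close>

definition small :: "nat set \<Rightarrow> bool list \<Rightarrow> bool" where
  "small C s \<longleftrightarrow> (\<forall>S \<subseteq> cylinder s. \<not> positive {n \<in> C. 1/2 \<le> \<bar>\<Phi> S n\<bar>})"

lemma small_mono:
  assumes "small C s" "D \<subseteq>* C"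
  shows "small D s"
  unfolding small_def
proof (intro allI impI notI)
  fix S assume S: "S \<subseteq> cylinder s" "positive {n \<in> D. 1/2 \<le> \<bar>\<Phi> S n\<bar>}"
  have "{n \<in> D. 1/2 \<le> \<bar>\<Phi> S n\<bar>} \<subseteq>* {n \<in> C. 1/2 \<le> \<bar>\<Phi> S n\<bar>}"
    using assms(2) unfolding almost_subset_def by (rule finite_subset[rotated]) auto
  then show False
    using assms(1) S positive_mono unfolding small_def by blast
qed

text \<open>
  The argument of Phillips and Whitley: each of the countably many functionals involved is
  negligible on all but finitely many members of an uncountable almost disjoint family.
\<close>

lemma infinite_cylinder_imp_not_small:
  assumes inf: "infinite {\<xi> \<in> hits C. trunc n (b \<xi>) = s}"
  shows "\<not> small C s"
proof
  assume small: "small C s"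
  obtain x :: "nat \<Rightarrow> 'i" where x: "inj x" "range x \<subseteq> {\<xi> \<in> hits C. trunc n (b \<xi>) = s}"
    using infinite_countable_subset[OF inf] by blast
  have x_hits: "infinite (C \<inter> A (x k))" for k
    using x(2) by (auto simp: hits_def)
  \<comment> \<open>Trimming to the cylinder and making the branches disjoint removes only a finite
    set from each, so the image of \<open>B k\<close> is still that of its branch.\<close>
  define B where "B k = branch (b (x k)) \<inter> cylinder s - (\<Union>j<k. branch (b (x j)))" for k
  have B_disj: "B j \<inter> B k = {}" if "j \<noteq> k" for j k
    using that unfolding B_def by (cases j k rule: linorder_cases) blast+
  have B_image: "(\<lambda>m. \<Phi> (B k) m - indicator (A (x k)) m) \<longlonglongrightarrow> 0" for k
  proof -
    let ?R = "branch (b (x k)) - B k"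
    have "finite (branch (b (x k)) \<inter> branch (b (x j)))" if "j < k" for j
      using that inj_b x(1) by (intro finite_branch_Int) (auto simp: inj_eq)
    then have "finite ((branch (b (x k)) - cylinder (trunc n (b (x k)))) \<union>
        (\<Union>j<k. branch (b (x k)) \<inter> branch (b (x j))))" (is "finite ?R'")
      using finite_branch_Diff_cylinder by (intro finite_UnI finite_UN_I) auto
    moreover have "trunc n (b (x k)) = s"
      using x(2) by blast
    then have "?R \<subseteq> ?R'"
      unfolding B_def by blast
    ultimately have fin: "finite ?R"
      by (metis finite_subset)
    have "B k \<union> ?R = branch (b (x k))"
      by (auto simp: B_def)
    then have "(\<lambda>m. \<Phi> (branch (b (x k))) m - \<Phi> (B k) m - \<Phi> ?R m) \<longlonglongrightarrow> 0"
      using additive[of "B k" ?R] by auto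
    from tendsto_diff[OF tendsto_diff[OF branch_image[of "x k"] this] finite_null[OF fin]]
    show ?thesis
      by (simp add: algebra_simps)
  qed
  \<comment> \<open>Limits along \<open>A (x k)\<close>, where \<open>\<Phi> (B j)\<close> tends to
    1 if \<open>j = k\<close> and to 0 otherwise.\<close>
  define F where "F k = inf sequentially (principal (A (x k)))" for k
  have indicator_lim: "((\<lambda>m. indicator (A (x j)) m :: real) \<longlongrightarrow> of_bool (j = k)) (F k)" for j k
  proof (cases "j = k")
    case True
    then show ?thesis
      unfolding F_def by (intro tendsto_eventually) (auto simp: eventually_inf_principal)
  next
    case False
    then have "finite (A (x j) \<inter> A (x k))"
      using almost_disjoint x(1) by (simp add: inj_eq)
    then have "\<forall>\<^sub>F m in sequentially. m \<notin> A (x j) \<inter> A (x k)"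
      by (simp add: cofinite_eq_sequentially[symmetric] eventually_cofinite Int_def)
    then have "\<forall>\<^sub>F m in F k. indicator (A (x j)) m = (0::real)"
      unfolding F_def eventually_inf_principal by eventually_elim (auto simp: indicator_def)
    then show ?thesis
      using False by (simp add: tendsto_eventually)
  qed
  \<comment> \<open>Branches reappear below in a second role, as an uncountable almost disjoint
    family of index sets \<open>M\<close>.\<close>
  define U where "U M = (\<Union>k\<in>M. B k)" for M
  have U_disj: "U M \<inter> U N = {}" if "M \<inter> N = {}" for M N
  proof -
    have "B j \<inter> B k = {}" if "j \<in> M" "k \<in> N" for j k
      using that \<open>M \<inter> N = {}\<close> by (intro B_disj) blast
    then show ?thesis
      unfolding U_def by blast
  qed
  have U_insert: "((\<lambda>m. \<Phi> (U (insert j M)) m - \<Phi> (U M) m) \<longlongrightarrow> of_bool (j = k)) (F k)"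
    if "j \<notin> M" for j k M
  proof -
    have "B j \<inter> U M = {}"
      using U_disj[of "{j}" M] that by (simp add: U_def)
    then have "(\<lambda>m. \<Phi> (B j \<union> U M) m - \<Phi> (B j) m - \<Phi> (U M) m) \<longlonglongrightarrow> 0"
      by (rule additive)
    from tendsto_add[OF this B_image[of j]]
    have "(\<lambda>m. \<Phi> (U (insert j M)) m - \<Phi> (U M) m - indicator (A (x j)) m) \<longlonglongrightarrow> 0"
      by (simp add: U_def algebra_simps)
    then have "((\<lambda>m. \<Phi> (U (insert j M)) m - \<Phi> (U M) m - indicator (A (x j)) m) \<longlongrightarrow> 0) (F k)"
      by (rule tendsto_mono[rotated]) (simp add: F_def)
    from tendsto_add[OF this indicator_lim[of j]] show ?thesis
      by simp
  qed
  have U_finite: "((\<lambda>m. \<Phi> (U (M \<union> J)) m - \<Phi> (U M) m) \<longlongrightarrow> 0) (F k)"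
    if "finite J" "J \<inter> M = {}" "k \<notin> J" for J M k
    using that
  proof (induction J)
    case (insert j J)
    then have "((\<lambda>m. \<Phi> (U (insert j (M \<union> J))) m - \<Phi> (U (M \<union> J)) m) \<longlongrightarrow> of_bool (j = k)) (F k)"
      by (intro U_insert) auto
    from tendsto_add[OF this insert.IH] insert.prems show ?case
      by auto
  qed simp
  \<comment> \<open>Along \<open>A (x k)\<close> finitely many pieces other than \<open>k\<close> do
    not matter, so the sets can be made disjoint by removing \<open>J\<close>, at the cost of
    \<open>1/8\<close> each. Boundedness then limits how many of them stay above
    \<open>1/4\<close>.\<close>
  have card_le: "real (card P) \<le> 8 * K"
    if P: "finite P" "infinite D" "D \<subseteq> A (x k)"
      "\<And>Y m. Y \<in> P \<Longrightarrow> m \<in> D \<Longrightarrow> 1/4 \<le> \<bar>\<Phi> (U (branch Y - {k})) m\<bar>" for P D k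
  proof -
    define J where "J = insert k (\<Union>Y\<in>P. \<Union>Z\<in>P - {Y}. branch Y \<inter> branch Z)"
    have "finite J"
      unfolding J_def using P(1) by (intro finite.insertI finite_UN_I finite_branch_Int) auto
    have "disjoint_family_on (\<lambda>Y. U (branch Y - J)) P"
      unfolding disjoint_family_on_def by (intro ballI impI U_disj) (auto simp: J_def)
    then have "\<forall>\<^sub>F m in sequentially. (\<Sum>Y\<in>P. \<bar>\<Phi> (U (branch Y - J)) m\<bar>) \<le> K"
      by (rule bounded[OF P(1)])
    then have 1: "\<forall>\<^sub>F m in F k. (\<Sum>Y\<in>P. \<bar>\<Phi> (U (branch Y - J)) m\<bar>) \<le> K"
      unfolding F_def by (rule filter_leD[rotated]) simp
    have "\<forall>\<^sub>F m in F k. \<forall>Y\<in>P. \<bar>\<Phi> (U (branch Y - {k})) m - \<Phi> (U (branch Y - J)) m\<bar> < 1/8"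
    proof (rule eventually_ball_finite[OF P(1)], intro ballI)
      fix Y
      have eq: "branch Y - J \<union> (branch Y \<inter> J - {k}) = branch Y - {k}"
        by (auto simp: J_def)
      have "((\<lambda>m. \<Phi> (U (branch Y - {k})) m - \<Phi> (U (branch Y - J)) m) \<longlongrightarrow> 0) (F k)"
        using U_finite[of "branch Y \<inter> J - {k}" "branch Y - J" k] \<open>finite J\<close> unfolding eq by auto
      from tendstoD[OF this, of "1/8"]
      show "\<forall>\<^sub>F m in F k. \<bar>\<Phi> (U (branch Y - {k})) m - \<Phi> (U (branch Y - J)) m\<bar> < 1/8"
        by (simp add: dist_real_def)
    qed
    from finite_not_eventually[OF eventually_conj[OF 1 this, unfolded F_def] P(3)]
    have "D - {m \<in> D. \<not> ((\<Sum>Y\<in>P. \<bar>\<Phi> (U (branch Y - J)) m\<bar>) \<le> K \<and>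
        (\<forall>Y\<in>P. \<bar>\<Phi> (U (branch Y - {k})) m - \<Phi> (U (branch Y - J)) m\<bar> < 1/8))} \<noteq> {}"
      by (intro infinite_imp_nonempty Diff_infinite_finite P(2))
    then obtain m where m: "m \<in> D" "(\<Sum>Y\<in>P. \<bar>\<Phi> (U (branch Y - J)) m\<bar>) \<le> K"
        "\<And>Y. Y \<in> P \<Longrightarrow> \<bar>\<Phi> (U (branch Y - {k})) m - \<Phi> (U (branch Y - J)) m\<bar> < 1/8"
      by blast
    have "1/8 \<le> \<bar>\<Phi> (U (branch Y - J)) m\<bar>" if "Y \<in> P" for Y
      using m(3)[OF that] P(4)[OF that m(1)] by linarith
    then have "(\<Sum>Y\<in>P. 1/8) \<le> (\<Sum>Y\<in>P. \<bar>\<Phi> (U (branch Y - J)) m\<bar>)"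
      by (rule sum_mono)
    then show ?thesis
      using m(2) by simp
  qed
  define negligible_off where "negligible_off k P D \<longleftrightarrow>
      finite P \<and> infinite D \<and> D \<subseteq> C \<inter> A (x k) \<and>
      (\<forall>Y. Y \<notin> P \<longrightarrow> finite {m \<in> D. 1/4 \<le> \<bar>\<Phi> (U (branch Y - {k})) m\<bar>})" for k P D
  have "\<exists>P D. negligible_off k P D" for k
  proof -
    \<comment> \<open>A \<open>P\<close> of greatest cardinality, which exists by
      \<open>card_le\<close>, absorbs all exceptional \<open>Y\<close>: one more that is large
      infinitely often on \<open>D\<close> could be added after shrinking \<open>D\<close>.\<close>
    define ok where "ok P D \<longleftrightarrow> finite P \<and> infinite D \<and> D \<subseteq> C \<inter> A (x k) \<and>
        (\<forall>Y\<in>P. \<forall>m\<in>D. 1/4 \<le> \<bar>\<Phi> (U (branch Y - {k})) m\<bar>)" for P D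
    have "\<exists>P. (\<exists>D. ok P D) \<and> (\<forall>Q. (\<exists>D. ok Q D) \<longrightarrow> card Q \<le> card P)"
    proof (rule ex_has_greatest_nat)
      show "\<exists>D. ok {} D"
        using x_hits[of k] unfolding ok_def by (intro exI[of _ "C \<inter> A (x k)"]) auto
      show "\<forall>Q. (\<exists>D. ok Q D) \<longrightarrow> card Q < Suc (nat \<lfloor>8 * K\<rfloor>)"
      proof (intro allI impI, elim exE)
        fix Q D assume "ok Q D"
        then have "real (card Q) \<le> 8 * K"
          unfolding ok_def by (intro card_le) auto
        then show "card Q < Suc (nat \<lfloor>8 * K\<rfloor>)"
          by (simp add: le_nat_floor less_Suc_eq_le)
      qed
    qed
    then obtain P D where P: "ok P D" "\<And>Q D. ok Q D \<Longrightarrow> card Q \<le> card P"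
      by blast
    have "finite {m \<in> D. 1/4 \<le> \<bar>\<Phi> (U (branch Y - {k})) m\<bar>}" (is "finite ?E") if "Y \<notin> P" for Y
    proof (rule ccontr)
      assume "infinite ?E"
      then have "ok (insert Y P) ?E"
        using P(1) unfolding ok_def by auto
      from P(2)[OF this] show False
        using that P(1) unfolding ok_def by simp
    qed
    then show ?thesis
      using P(1) unfolding ok_def negligible_off_def by blast
  qed
  then obtain P D where "\<And>k. negligible_off k (P k) (D k)"
    by metis
  then have P: "\<And>k. finite (P k)" "\<And>k. infinite (D k)" "\<And>k. D k \<subseteq> C \<inter> A (x k)"
      "\<And>k Y. Y \<notin> P k \<Longrightarrow> finite {m \<in> D k. 1/4 \<le> \<bar>\<Phi> (U (branch Y - {k})) m\<bar>}"
    unfolding negligible_off_def by blast+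
  have "countable (\<Union>k. P k)"
    using P(1) by (auto intro: countable_finite)
  \<comment> \<open>Countably many finite exceptional sets leave a \<open>Y\<close> that works for
    every \<open>k\<close> at once.\<close>
  then obtain Y where Y: "\<And>k. Y \<notin> P k"
    using uncountable_UNIV_nat_set by (metis UNIV_I UN_I countable_subset subsetI)
  \<comment> \<open>Up to finitely many points of \<open>D k\<close>, piece \<open>k\<close>
    contributes more than \<open>3/4\<close> and the other pieces together less than
    \<open>1/4\<close> in absolute value.\<close>
  have "x k \<in> hits {m \<in> C. 1/2 \<le> \<bar>\<Phi> (U (branch Y)) m\<bar>}" if "k \<in> branch Y" for k
  proof -
    have "((\<lambda>m. \<Phi> (U (branch Y)) m - \<Phi> (U (branch Y - {k})) m) \<longlongrightarrow> 1) (F k)"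
      using U_insert[of k "branch Y - {k}" k] that by (simp add: insert_absorb)
    then have "\<forall>\<^sub>F m in F k. 3/4 < \<Phi> (U (branch Y)) m - \<Phi> (U (branch Y - {k})) m"
      by (rule order_tendstoD) simp
    then have "finite {m \<in> D k. \<not> 3/4 < \<Phi> (U (branch Y)) m - \<Phi> (U (branch Y - {k})) m}" (is "finite ?E1")
      unfolding F_def using P(3) by (intro finite_not_eventually) auto
    moreover have "finite {m \<in> D k. 1/4 \<le> \<bar>\<Phi> (U (branch Y - {k})) m\<bar>}" (is "finite ?E2")
      using Y by (rule P(4))
    ultimately have "infinite (D k - (?E1 \<union> ?E2))"
      by (intro Diff_infinite_finite finite_UnI P(2))
    moreover have "D k - (?E1 \<union> ?E2) \<subseteq> {m \<in> C. 1/2 \<le> \<bar>\<Phi> (U (branch Y)) m\<bar>} \<inter> A (x k)"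
    proof
      fix m assume m: "m \<in> D k - (?E1 \<union> ?E2)"
      then have "1/2 \<le> \<bar>\<Phi> (U (branch Y)) m\<bar>"
        by (simp add: not_less not_le) linarith
      then show "m \<in> {m \<in> C. 1/2 \<le> \<bar>\<Phi> (U (branch Y)) m\<bar>} \<inter> A (x k)"
        using m P(3)[of k] by blast
    qed
    ultimately show ?thesis
      unfolding hits_def using finite_subset by blast
  qed
  then have "x ` branch Y \<subseteq> hits {m \<in> C. 1/2 \<le> \<bar>\<Phi> (U (branch Y)) m\<bar>}"
    by blast
  moreover have "infinite (x ` branch Y)"
    using infinite_branch x(1) by (meson finite_imageD inj_on_subset subset_UNIV)
  ultimately have "positive {m \<in> C. 1/2 \<le> \<bar>\<Phi> (U (branch Y)) m\<bar>}"
    unfolding positive_def using finite_subset by blast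
  moreover have "U (branch Y) \<subseteq> cylinder s"
    unfolding U_def B_def by blast
  ultimately show False
    using small unfolding small_def by blast
qed

text \<open>Smallness passes to almost subsets, so each of the countably many strings is settled for
  good by one shrinking, and a positive pseudo-intersection settles all of them.\<close>

lemma stabilize:
  assumes "positive C"
  obtains D where "positive D" "D \<subseteq>* C"
    "\<And>s D'. D' \<subseteq>* D \<Longrightarrow> positive D' \<Longrightarrow> small D' s \<Longrightarrow> small D s"
proof -
  define stable where "stable D s \<longleftrightarrow> small D s \<or> (\<forall>D'. D' \<subseteq>* D \<and> positive D' \<longrightarrow> \<not> small D' s)" for D s
  have stable_mono: "stable D' s" if "stable D s" "D' \<subseteq>* D" for D D' s
    using that small_mono almost_subset_trans unfolding stable_def by blast
  have ex: "\<exists>D'. positive D' \<and> D' \<subseteq> D \<and> stable D' s" if "positive D" for D s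
  proof (cases "stable D s")
    case True
    then show ?thesis
      using that by blast
  next
    case False
    then obtain D' where D': "D' \<subseteq>* D" "positive D'" "small D' s"
      unfolding stable_def by blast
    \<comment> \<open>Intersecting with \<open>D\<close> turns almost inclusion into inclusion, as
      needed for a decreasing sequence.\<close>
    have "D' \<subseteq>* D \<inter> D'"
      using D'(1) unfolding almost_subset_def by (rule finite_subset[rotated]) blast
    then have "positive (D \<inter> D')"
      using D'(2) positive_mono by blast
    moreover have "small (D \<inter> D') s"
      using D'(3) small_mono subset_imp_almost_subset[of "D \<inter> D'" D'] by blast
    ultimately show ?thesis
      unfolding stable_def by blast
  qed
  have "\<exists>E. \<forall>n. positive (E n) \<and> (n = 0 \<longrightarrow> E n = C) \<and> E (Suc n) \<subseteq> E n \<and> stable (E (Suc n)) (from_nat n)"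
  proof -
    have "\<exists>E. \<forall>n. (positive (E n) \<and> (n = 0 \<longrightarrow> E n = C)) \<and>
        (E (Suc n) \<subseteq> E n \<and> stable (E (Suc n)) (from_nat n))"
      by (rule dependent_nat_choice) (use assms ex in auto)
    then show ?thesis
      by blast
  qed
  then obtain E where E: "\<And>n. positive (E n)" "E 0 = C" "\<And>n. E (Suc n) \<subseteq> E n"
      "\<And>n. stable (E (Suc n)) (from_nat n)"
    by auto
  have "decseq E"
    using E(3) by (rule decseq_SucI)
  then obtain D where D: "positive D" "\<And>n. D \<subseteq>* E n"
    using E(1) by (rule positive_pseudo_intersection) blast
  have "stable D s" for s
    using stable_mono[OF E(4) D(2), of "to_nat s"] by simp
  then show thesis
    using that[of D] D D(2)[of 0] E(2) unfolding stable_def by blast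
qed

text \<open>After stabilisation the failure of smallness is hereditary, so large images from many
  disjoint cylinders can be collected on one positive set, where their sum exceeds
  \<open>K\<close>.\<close>

lemma not_positive_UNIV: "\<not> positive UNIV"
proof
  assume "positive UNIV"
  then obtain C where C: "positive C"
      "\<And>s D. D \<subseteq>* C \<Longrightarrow> positive D \<Longrightarrow> small D s \<Longrightarrow> small C s"
    by (rule stabilize) blast
  have "uncountable (b ` hits C)"
    using uncountable_hits[OF C(1)] inj_b by (meson countable_image_inj_on inj_on_subset subset_UNIV)
  \<comment> \<open>More than \<open>2 * K\<close> cylinders, each of which will contribute at least
    \<open>1/2\<close>.\<close>
  then obtain n G where G: "card G = Suc (nat \<lceil>2 * K\<rceil>)" "finite G" "\<And>s. s \<in> G \<Longrightarrow> length s = n"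
      "\<And>s. s \<in> G \<Longrightarrow> infinite {X \<in> b ` hits C. trunc n X = s}"
    by (rule uncountable_many_cylinders) blast
  have not_small: "\<not> small C s" if "s \<in> G" for s
  proof (rule infinite_cylinder_imp_not_small)
    have "{X \<in> b ` hits C. trunc n X = s} = b ` {\<xi> \<in> hits C. trunc n (b \<xi>) = s}"
      by blast
    then show "infinite {\<xi> \<in> hits C. trunc n (b \<xi>) = s}"
      using G(4)[OF that] by auto
  qed
  have "\<exists>D S. D \<subseteq> C \<and> positive D \<and> (\<forall>s\<in>G'. S s \<subseteq> cylinder s \<and> (\<forall>m\<in>D. 1/2 \<le> \<bar>\<Phi> (S s) m\<bar>))"
    if "finite G'" "G' \<subseteq> G" for G'
    using that
  proof (induction G')
    case empty
    then show ?case
      using C(1) by blast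
  next
    case (insert s G')
    then obtain D S where D: "D \<subseteq> C" "positive D"
        "\<And>s. s \<in> G' \<Longrightarrow> S s \<subseteq> cylinder s" "\<And>s m. s \<in> G' \<Longrightarrow> m \<in> D \<Longrightarrow> 1/2 \<le> \<bar>\<Phi> (S s) m\<bar>"
      by (metis insert_subset)
    \<comment> \<open>By the choice of \<open>C\<close>, smallness on the positive subset
      \<open>D\<close> would give smallness on \<open>C\<close>.\<close>
    have "\<not> small D s"
      using C(2) D(1,2) not_small insert.prems subset_imp_almost_subset by blast
    then obtain T where T: "T \<subseteq> cylinder s" "positive {m \<in> D. 1/2 \<le> \<bar>\<Phi> T m\<bar>}"
      unfolding small_def by blast
    show ?case
      by (rule exI[of _ "{m \<in> D. 1/2 \<le> \<bar>\<Phi> T m\<bar>}"], rule exI[of _ "S(s := T)"])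
        (use D T insert.hyps in auto)
  qed
  from this[OF G(2)] obtain D S where D: "positive D" "\<And>s. s \<in> G \<Longrightarrow> S s \<subseteq> cylinder s"
      "\<And>s m. s \<in> G \<Longrightarrow> m \<in> D \<Longrightarrow> 1/2 \<le> \<bar>\<Phi> (S s) m\<bar>"
    by blast
  have "disjoint_family_on S G"
    unfolding disjoint_family_on_def using D(2) cylinder_disjoint G(3) by blast
  then have "\<forall>\<^sub>F m in sequentially. (\<Sum>s\<in>G. \<bar>\<Phi> (S s) m\<bar>) \<le> K"
    by (rule bounded[OF G(2)])
  then obtain N where N: "\<And>m. m \<ge> N \<Longrightarrow> (\<Sum>s\<in>G. \<bar>\<Phi> (S s) m\<bar>) \<le> K"
    unfolding eventually_sequentially by blast
  obtain m where m: "m \<in> D" "m \<ge> N"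
    using positive_imp_infinite[OF D(1)] unfolding infinite_nat_iff_unbounded_le by blast
  have "(\<Sum>s\<in>G. 1/2) \<le> (\<Sum>s\<in>G. \<bar>\<Phi> (S s) m\<bar>)"
    using D(3) m(1) by (intro sum_mono) blast
  then have "real (card G) / 2 \<le> K"
    using N[OF m(2)] by simp
  then show False
    using G(1) by linarith
qed

end

section \<open>Indicator functions in \<open>\<ell>\<^sub>\<infinity>/c\<^sub>0\<close>\<close>

lemma linear_abs_linfty_mod_c0: "linear abs_linfty_mod_c0"
  by (rule linearI) (simp_all add: plus_linfty_mod_c0.abs_eq scaleR_linfty_mod_c0.abs_eq)

lemma apply_Bcontfun:
  fixes f :: "nat \<Rightarrow> real"
  assumes "\<And>n. \<bar>f n\<bar> \<le> c"
  shows "apply_bcontfun (Bcontfun f) = f"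
  using assms by (intro Bcontfun_inverse bcontfun_normI[where b = c]) auto

lemma apply_bcontfun_sum: "apply_bcontfun (\<Sum>i\<in>I. f i) n = (\<Sum>i\<in>I. apply_bcontfun (f i) n)"
  by (induction I rule: infinite_finite_induct) auto

text \<open>With the next lemma this identifies the quotient norm as the limit superior of the
  absolute values. Setting the finitely many entries beyond \<open>c\<close> to 0 gives a suitable
  representative.\<close>

lemma norm_abs_linfty_mod_c0_le:
  assumes "0 \<le> c" "\<forall>\<^sub>F n in sequentially. \<bar>apply_bcontfun x n\<bar> \<le> c"
  shows "norm (abs_linfty_mod_c0 x) \<le> c"
proof -
  define f where "f n = (if \<bar>apply_bcontfun x n\<bar> \<le> c then apply_bcontfun x n else 0)" for n
  have f: "\<bar>f n\<bar> \<le> c" for n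
    using assms(1) by (simp add: f_def)
  note app = apply_Bcontfun[OF f]
  have "\<forall>\<^sub>F n in sequentially. apply_bcontfun (x - Bcontfun f) n = 0"
    using assms(2) by eventually_elim (simp add: app, simp add: f_def)
  then have "x - Bcontfun f \<in> null_sequences"
    unfolding null_sequences_def by (simp add: tendsto_eventually)
  then have "norm (abs_linfty_mod_c0 x) \<le> norm (Bcontfun f)"
    unfolding norm_linfty_mod_c0.abs_eq by (rule quotient_norm_le[OF subspace_null_sequences])
  also have "\<dots> \<le> c"
    using f by (intro norm_bound) (simp add: app)
  finally show ?thesis .
qed

text \<open>A representative \<open>y\<close> of norm below \<open>r\<close> differs from
  \<open>x\<close> by a null sequence, eventually smaller than the gap
  \<open>r - norm y\<close>.\<close>

lemma eventually_less_norm_abs_linfty_mod_c0: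
  assumes "norm (abs_linfty_mod_c0 x) < r"
  shows "\<forall>\<^sub>F n in sequentially. \<bar>apply_bcontfun x n\<bar> < r"
proof -
  obtain y where y: "x - y \<in> null_sequences" "norm y < r"
    using assms unfolding norm_linfty_mod_c0.abs_eq
    by (rule quotient_norm_approx[OF subspace_null_sequences])
  have "(\<lambda>n. apply_bcontfun x n - apply_bcontfun y n) \<longlonglongrightarrow> 0"
    using y(1) unfolding null_sequences_def by simp
  then have "\<forall>\<^sub>F n in sequentially. \<bar>apply_bcontfun x n - apply_bcontfun y n\<bar> < r - norm y"
    using y(2) by (auto simp: dist_real_def dest!: tendstoD[where e = "r - norm y"])
  then show ?thesis
  proof eventually_elim
    case (elim n)
    then show ?case
      using norm_bounded[of y n] by simp
  qed
qed

definition indicator_class :: "nat set \<Rightarrow> linfty_mod_c0" where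
  "indicator_class S = abs_linfty_mod_c0 (Bcontfun (indicator S))"

lemma apply_Bcontfun_indicator: "apply_bcontfun (Bcontfun (indicator S)) = (indicator S :: nat \<Rightarrow> real)"
  by (rule apply_Bcontfun[of _ 1]) (simp add: indicator_def)

lemma sum_indicator_class:
  "(\<Sum>i\<in>I. a i *\<^sub>R indicator_class (S i)) =
     abs_linfty_mod_c0 (\<Sum>i\<in>I. a i *\<^sub>R Bcontfun (indicator (S i)))"
  by (simp add: indicator_class_def linear_sum[OF linear_abs_linfty_mod_c0]
      linear_scale[OF linear_abs_linfty_mod_c0])

lemma apply_sum_indicator:
  fixes S :: "'i \<Rightarrow> nat set"
  shows "apply_bcontfun (\<Sum>i\<in>I. a i *\<^sub>R Bcontfun (indicator (S i))) n = (\<Sum>i\<in>I. a i * indicator (S i) n)"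
  by (simp add: apply_bcontfun_sum apply_Bcontfun_indicator)

lemma norm_sum_indicator_class_le:
  assumes "0 \<le> c" "\<forall>\<^sub>F n in sequentially. \<bar>\<Sum>i\<in>I. a i * indicator (S i) n\<bar> \<le> c"
  shows "norm (\<Sum>i\<in>I. a i *\<^sub>R indicator_class (S i)) \<le> c"
  unfolding sum_indicator_class
  by (rule norm_abs_linfty_mod_c0_le) (simp_all add: assms apply_sum_indicator)

lemma eventually_less_norm_sum_indicator_class:
  assumes "norm (\<Sum>i\<in>I. a i *\<^sub>R indicator_class (S i)) < r"
  shows "\<forall>\<^sub>F n in sequentially. \<bar>\<Sum>i\<in>I. a i * indicator (S i) n\<bar> < r"
  using eventually_less_norm_abs_linfty_mod_c0[OF assms[unfolded sum_indicator_class]]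
  by (simp add: apply_sum_indicator)

lemma indicator_class_Un:
  assumes "S \<inter> T = {}"
  shows "indicator_class (S \<union> T) = indicator_class S + indicator_class T"
proof -
  have "Bcontfun (indicator (S \<union> T)) = Bcontfun (indicator S) + (Bcontfun (indicator T) :: linfty)"
    using assms by (intro bcontfun_eqI) (auto simp: apply_Bcontfun_indicator indicator_def)
  then show ?thesis
    by (simp add: indicator_class_def linear_add[OF linear_abs_linfty_mod_c0])
qed

lemma indicator_class_finite:
  assumes "finite S"
  shows "indicator_class S = 0"
proof -
  have "\<forall>\<^sub>F n in sequentially. n \<notin> S"
    using assms by (simp add: cofinite_eq_sequentially[symmetric] eventually_cofinite)
  then have "\<forall>\<^sub>F n in sequentially. \<bar>apply_bcontfun (Bcontfun (indicator S)) n\<bar> \<le> (0::real)"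
    by eventually_elim (simp add: apply_Bcontfun_indicator)
  then have "norm (indicator_class S) \<le> 0"
    unfolding indicator_class_def by (intro norm_abs_linfty_mod_c0_le) auto
  then show ?thesis
    by simp
qed

section \<open>The copy of \<open>c\<^sub>0(\<Gamma>)\<close> given by an almost disjoint family\<close>

locale ad_family =
  fixes E :: "'i \<Rightarrow> nat set"
  assumes infinite: "infinite (E i)"
    and finite_Int: "i \<noteq> j \<Longrightarrow> finite (E i \<inter> E j)"
begin

lemma eventually_unique:
  assumes "finite I"
  shows "\<forall>\<^sub>F n in sequentially. \<forall>i\<in>I. \<forall>j\<in>I. n \<in> E i \<longrightarrow> n \<in> E j \<longrightarrow> i = j"
proof (intro eventually_ball_finite assms ballI)
  fix i j
  show "\<forall>\<^sub>F n in sequentially. n \<in> E i \<longrightarrow> n \<in> E j \<longrightarrow> i = j"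
    using finite_Int[of i j]
    by (cases "i = j") (auto simp: cofinite_eq_sequentially[symmetric] eventually_cofinite Int_def)
qed

text \<open>Far out at most one summand is nonzero.\<close>

lemma norm_sum_le:
  assumes "finite I" "0 \<le> c" "\<And>i. i \<in> I \<Longrightarrow> \<bar>a i\<bar> \<le> c"
  shows "norm (\<Sum>i\<in>I. a i *\<^sub>R indicator_class (E i)) \<le> c"
proof (rule norm_sum_indicator_class_le[OF assms(2)])
  show "\<forall>\<^sub>F n in sequentially. \<bar>\<Sum>i\<in>I. a i * indicator (E i) n\<bar> \<le> c"
    using eventually_unique[OF assms(1)]
  proof eventually_elim
    case (elim n)
    show ?case
    proof (cases "\<exists>i\<in>I. n \<in> E i")
      case True
      then obtain i where i: "i \<in> I" "n \<in> E i"
        by blast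
      have "(\<Sum>j\<in>I. a j * indicator (E j) n) = (\<Sum>j\<in>I. if i = j then a i else 0)"
        using elim i by (intro sum.cong) (auto simp: indicator_def)
      then show ?thesis
        using assms i by simp
    next
      case False
      then have "(\<Sum>j\<in>I. a j * indicator (E j) n) = 0"
        by (intro sum.neutral) auto
      then show ?thesis
        using assms(2) by simp
    qed
  qed
qed

text \<open>On a tail of the infinite set \<open>E i\<close> only summand \<open>i\<close> survives,
  so the combination takes the value \<open>a i\<close> infinitely often.\<close>

lemma norm_sum_ge:
  assumes "finite I" "i \<in> I"
  shows "\<bar>a i\<bar> \<le> norm (\<Sum>i\<in>I. a i *\<^sub>R indicator_class (E i))"
proof (rule ccontr)
  assume "\<not> \<bar>a i\<bar> \<le> norm (\<Sum>i\<in>I. a i *\<^sub>R indicator_class (E i))"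
  then have "\<forall>\<^sub>F n in sequentially. \<bar>\<Sum>i\<in>I. a i * indicator (E i) n\<bar> < \<bar>a i\<bar>"
    by (intro eventually_less_norm_sum_indicator_class) simp
  with eventually_unique[OF assms(1)]
  have "\<forall>\<^sub>F n in sequentially. n \<notin> E i"
  proof eventually_elim
    case (elim n)
    show ?case
    proof
      assume "n \<in> E i"
      then have "(\<Sum>j\<in>I. a j * indicator (E j) n) = (\<Sum>j\<in>I. if i = j then a i else 0)"
        using elim assms(2) by (intro sum.cong) (auto simp: indicator_def)
      then show False
        using elim(2) assms by simp
    qed
  qed
  then show False
    using infinite[of i] by (simp add: cofinite_eq_sequentially[symmetric] eventually_cofinite)
qed

text \<open>An unconditional sum, since the index set may be uncountable; the next lemma rules out
  the default value 0 of a divergent sum.\<close>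

definition embed :: "'i c0 \<Rightarrow> linfty_mod_c0" where
  "embed f = (\<Sum>\<^sub>\<infinity>i. apply_c0 f i *\<^sub>R indicator_class (E i))"

text \<open>Cauchy criterion: partial sums over two finite sets containing all large coordinates
  differ only in small ones, and \<open>norm_sum_le\<close> bounds that difference
  uniformly.\<close>

lemma summable: "(\<lambda>i. apply_c0 f i *\<^sub>R indicator_class (E i)) summable_on UNIV"
proof -
  let ?g = "\<lambda>i. apply_c0 f i *\<^sub>R indicator_class (E i)"
  have "cauchy_filter (filtermap (sum ?g) (finite_subsets_at_top UNIV))"
    unfolding cauchy_filter_metric_filtermap
  proof (intro allI impI)
    fix e :: real assume e: "e > 0"
    define D where "D = {i. e / 2 \<le> \<bar>apply_c0 f i\<bar>}"
    have D: "finite D"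
      using e finite_c0[of "e / 2" f] unfolding D_def by simp
    have close: "dist (sum ?g F) (sum ?g G) < e"
      if F: "finite F" "D \<subseteq> F" and G: "finite G" "D \<subseteq> G" for F G
    proof -
      have "sum ?g F - sum ?g G = (\<Sum>i\<in>F \<union> G. (apply_c0 f i * (indicator F i - indicator G i)) *\<^sub>R indicator_class (E i))"
      proof -
        have "sum ?g F = (\<Sum>i\<in>F \<union> G. (apply_c0 f i * indicator F i) *\<^sub>R indicator_class (E i))"
          using F G by (intro sum.mono_neutral_cong_left) (auto simp: indicator_def)
        moreover have "sum ?g G = (\<Sum>i\<in>F \<union> G. (apply_c0 f i * indicator G i) *\<^sub>R indicator_class (E i))"
          using F G by (intro sum.mono_neutral_cong_left) (auto simp: indicator_def)
        ultimately show ?thesis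
          by (simp add: sum_subtractf[symmetric] right_diff_distrib scaleR_left_diff_distrib)
      qed
      also have "norm \<dots> \<le> e / 2"
      proof (rule norm_sum_le)
        fix i
        show "\<bar>apply_c0 f i * (indicator F i - indicator G i)\<bar> \<le> e / 2"
          using F(2) G(2) e by (cases "i \<in> D") (auto simp: D_def indicator_def)
      qed (use F G e in auto)
      finally show ?thesis
        using e by (simp add: dist_norm)
    qed
    show "\<exists>P. eventually P (finite_subsets_at_top UNIV) \<and>
        (\<forall>F G. P F \<and> P G \<longrightarrow> dist (sum ?g F) (sum ?g G) < e)"
      by (rule exI[of _ "\<lambda>F. finite F \<and> D \<subseteq> F"])
        (use D close in \<open>auto simp: eventually_finite_subsets_at_top\<close>)
  qed
  moreover have "complete (UNIV :: linfty_mod_c0 set)"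
    by (meson Cauchy_convergent UNIV_I complete_def convergent_def)
  ultimately obtain l where "(sum ?g \<longlongrightarrow> l) (finite_subsets_at_top UNIV)"
    using complete_uniform[where S = UNIV] by (force simp: filterlim_def)
  then show ?thesis
    using summable_on_def has_sum_def by blast
qed

lemma has_sum_embed: "((\<lambda>i. apply_c0 f i *\<^sub>R indicator_class (E i)) has_sum embed f) UNIV"
  unfolding embed_def by (rule has_sum_infsum[OF summable])

lemma norm_embed: "norm (embed f) = norm f"
proof (rule antisym)
  have lim: "((\<lambda>F. norm (\<Sum>i\<in>F. apply_c0 f i *\<^sub>R indicator_class (E i))) \<longlongrightarrow> norm (embed f))
      (finite_subsets_at_top UNIV)"
    using has_sum_embed[of f] unfolding has_sum_def by (rule tendsto_norm)
  show "norm (embed f) \<le> norm f"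
    by (rule tendsto_upperbound[OF lim])
      (auto intro!: eventually_finite_subsets_at_top_weakI norm_sum_le abs_apply_c0_le_norm)
  show "norm f \<le> norm (embed f)"
  proof (rule norm_c0_le)
    fix i
    show "\<bar>apply_c0 f i\<bar> \<le> norm (embed f)"
    proof (rule tendsto_lowerbound[OF lim])
      show "\<forall>\<^sub>F F in finite_subsets_at_top UNIV.
          \<bar>apply_c0 f i\<bar> \<le> norm (\<Sum>i\<in>F. apply_c0 f i *\<^sub>R indicator_class (E i))"
        unfolding eventually_finite_subsets_at_top
        by (rule exI[of _ "{i}"]) (auto intro: norm_sum_ge)
    qed simp
  qed
qed

lemma linear_embed: "linear embed"
proof (rule linearI)
  show "embed (f + g) = embed f + embed g" for f g
    unfolding embed_def
    by (simp add: plus_c0.rep_eq scaleR_left_distrib infsum_add summable)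
  show "embed (c *\<^sub>R f) = c *\<^sub>R embed f" for c f
    unfolding embed_def
    by (simp add: scaleR_c0.rep_eq infsum_scaleR_right flip: scaleR_scaleR)
qed

lemma bounded_linear_embed: "bounded_linear embed"
  by (rule bounded_linear_intro[where K = 1])
    (simp_all add: norm_embed linear_add[OF linear_embed] linear_scale[OF linear_embed])

lemma inj_embed: "inj embed"
proof (rule injI)
  fix f g assume "embed f = embed g"
  then have "norm (f - g) = 0"
    by (simp add: norm_embed[symmetric] linear_diff[OF linear_embed])
  then show "f = g"
    by simp
qed

lemma subspace_range_embed: "subspace (range embed)"
  using linear_subspace_image[OF linear_embed subspace_UNIV] .

lemma closed_range_embed: "closed (range embed)"
proof -
  have "complete (range embed)"
  proof (rule complete_isometric_image[OF zero_less_one subspace_UNIV bounded_linear_embed])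
    show "complete (UNIV :: 'i c0 set)"
      by (meson Cauchy_convergent UNIV_I complete_def convergent_def)
  qed (simp add: norm_embed)
  then show ?thesis
    by (rule complete_imp_closed)
qed

lemma linear_on_inv_embed: "linear_on_subspace (range embed) (inv embed)"
  unfolding linear_on_subspace_def
  by (auto simp: inj_embed linear_add[OF linear_embed, symmetric] linear_scale[OF linear_embed, symmetric])

lemma homeomorphism_inv_embed: "homeomorphism (range embed) UNIV (inv embed) embed"
proof
  show "continuous_on (range embed) (inv embed)"
  proof (rule continuous_on_iff[THEN iffD2], intro ballI allI impI)
    fix x and e :: real assume "x \<in> range embed" "e > 0"
    moreover have "dist (inv embed y) (inv embed x) = dist y x" if "x \<in> range embed" "y \<in> range embed" for x y
      using that by (auto simp: dist_norm inj_embed norm_embed simp flip: linear_diff[OF linear_embed])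
    ultimately show "\<exists>d>0. \<forall>x'\<in>range embed. dist x' x < d \<longrightarrow> dist (inv embed x') (inv embed x) < e"
      by auto
  qed
  show "continuous_on UNIV embed"
    by (rule linear_continuous_on[OF bounded_linear_embed])
qed (auto simp: inj_embed)

lemma isomorphic_range_embed: "closed_subspace_isomorphic_to TYPE('i c0) (range embed)"
  unfolding closed_subspace_isomorphic_to_def isomorphism_between_def
  using subspace_range_embed closed_range_embed linear_on_inv_embed homeomorphism_inv_embed by blast

lemma embed_unit:
  obtains f where "embed f = indicator_class (E i)" "apply_c0 f = (\<lambda>j. of_bool (j = i))"
proof
  have "finite {j. e \<le> \<bar>of_bool (j = i) :: real\<bar>}" if "e > 0" for e
    by (rule finite_subset[of _ "{i}"]) (use that in auto)
  then have app: "apply_c0 (Abs_c0 (\<lambda>j. of_bool (j = i))) = (\<lambda>j. of_bool (j = i))"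
    by (simp add: Abs_c0_inverse)
  then show "apply_c0 (Abs_c0 (\<lambda>j. of_bool (j = i))) = (\<lambda>j. of_bool (j = i))" .
  have "((\<lambda>j. apply_c0 (Abs_c0 (\<lambda>j. of_bool (j = i))) j *\<^sub>R indicator_class (E j)) has_sum indicator_class (E i)) UNIV"
    by (rule has_sum_finite_neutralI[of "{i}"]) (auto simp: app)
  then show "embed (Abs_c0 (\<lambda>j. of_bool (j = i))) = indicator_class (E i)"
    unfolding embed_def by (rule infsumI)
qed

section \<open>The codimension of the copy\<close>

text \<open>Up to \<open>1/4\<close>, \<open>z\<close> is a finite combination. Some
  \<open>E (x k)\<close> with \<open>k \<in> K\<close> lies outside its index set, and on almost all
  of it the difference of the indicators is 1 while the combination vanishes.\<close>

lemma dist_range_embed: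
  assumes "inj x" "infinite K" "\<And>k. k \<in> K \<Longrightarrow> finite (E (x k) - S)" "\<And>k. k \<in> K \<Longrightarrow> finite (E (x k) \<inter> T)"
    and z: "z \<in> range embed"
  shows "3/4 \<le> norm (indicator_class S - indicator_class T - z)"
proof (rule ccontr)
  assume less: "\<not> 3/4 \<le> norm (indicator_class S - indicator_class T - z)"
  obtain f where f: "z = embed f"
    using z by blast
  obtain F where F: "finite F" "dist (\<Sum>i\<in>F. apply_c0 f i *\<^sub>R indicator_class (E i)) z \<le> 1/4"
    using has_sum_finite_approximation[OF has_sum_embed[of f], of "1/4"] f by auto
  let ?y = "Bcontfun (indicator S) - Bcontfun (indicator T) - (\<Sum>i\<in>F. apply_c0 f i *\<^sub>R Bcontfun (indicator (E i)))"
  have "norm (indicator_class S - indicator_class T - (\<Sum>i\<in>F. apply_c0 f i *\<^sub>R indicator_class (E i))) < 1"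
    using less F(2) norm_triangle_ineq[of "indicator_class S - indicator_class T - z"
        "z - (\<Sum>i\<in>F. apply_c0 f i *\<^sub>R indicator_class (E i))"]
    by (simp add: dist_norm norm_minus_commute)
  then have "norm (abs_linfty_mod_c0 ?y) < 1"
    unfolding sum_indicator_class unfolding indicator_class_def
    by (simp add: linear_diff[OF linear_abs_linfty_mod_c0])
  then have "\<forall>\<^sub>F n in sequentially. \<bar>indicator S n - indicator T n - (\<Sum>i\<in>F. apply_c0 f i * indicator (E i) n)\<bar> < 1"
    using eventually_less_norm_abs_linfty_mod_c0[of ?y 1]
    by (simp add: apply_sum_indicator apply_Bcontfun_indicator)
  then have fin: "finite {n. \<not> \<bar>indicator S n - indicator T n - (\<Sum>i\<in>F. apply_c0 f i * indicator (E i) n)\<bar> < 1}" (is "finite ?B")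
    by (simp add: cofinite_eq_sequentially[symmetric] eventually_cofinite)
  have "finite (x -` F)"
    using finite_vimageI[OF F(1) assms(1)] .
  then have "K - x -` F \<noteq> {}"
    using assms(2) by (intro infinite_imp_nonempty Diff_infinite_finite)
  then obtain k where k: "k \<in> K" "x k \<notin> F"
    by blast
  have "finite (\<Union>i\<in>F. E (x k) \<inter> E i)"
    using F(1) k(2) by (intro finite_UN_I finite_Int) auto
  then have "E (x k) - ((E (x k) - S) \<union> (E (x k) \<inter> T) \<union> (\<Union>i\<in>F. E (x k) \<inter> E i) \<union> ?B) \<noteq> {}"
    using fin assms(3,4)[OF k(1)] infinite[of "x k"]
    by (intro infinite_imp_nonempty Diff_infinite_finite finite_UnI)
  then obtain n where n: "n \<in> E (x k)" "n \<in> S" "n \<notin> T" "\<And>i. i \<in> F \<Longrightarrow> n \<notin> E i" "n \<notin> ?B"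
    by blast
  then have "(\<Sum>i\<in>F. apply_c0 f i * indicator (E i) n) = 0"
    by (intro sum.neutral) auto
  then show False
    using n by simp
qed

end

context ad_family
begin

text \<open>Unions of members over distinct branches: infinitely many members are almost contained
  in the first union and almost disjoint from the second.\<close>

lemma separated_classes:
  assumes "infinite (UNIV :: 'i set)"
  obtains v :: "nat set \<Rightarrow> linfty_mod_c0"
  where "\<And>X Y. X \<noteq> Y \<Longrightarrow> 3/4 \<le> quotient_norm (range embed) (v X - v Y)"
proof -
  obtain x :: "nat \<Rightarrow> 'i" where x: "inj x"
    using infinite_countable_subset[OF assms] by blast
  \<comment> \<open>Without this disjointification an infinite union could meet a member outside it
    in an infinite set.\<close>
  define E' where "E' k = E (x k) - (\<Union>j<k. E (x j))" for k
  define V where "V X = (\<Union>k\<in>branch X. E' k)" for X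
  have fin: "finite (\<Union>j<k. E (x k) \<inter> E (x j))" for k
    using x by (intro finite_UN_I finite_Int) (auto simp: inj_eq)
  have sub: "finite (E (x k) - V X)" if "k \<in> branch X" for k X
    by (rule finite_subset[OF _ fin[of k]]) (use that in \<open>auto simp: V_def E'_def\<close>)
  have disj: "finite (E (x k) \<inter> V X)" if "k \<notin> branch X" for k X
  proof (rule finite_subset[OF _ fin[of k]])
    show "E (x k) \<inter> V X \<subseteq> (\<Union>j<k. E (x k) \<inter> E (x j))"
    proof
      fix n assume n: "n \<in> E (x k) \<inter> V X"
      then obtain l where l: "l \<in> branch X" "n \<in> E' l"
        unfolding V_def by blast
      then have "l < k"
        using n that unfolding E'_def by (cases l k rule: linorder_cases) auto
      then show "n \<in> (\<Union>j<k. E (x k) \<inter> E (x j))"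
        using n l(2) unfolding E'_def by blast
    qed
  qed
  show thesis
  proof
    fix X Y :: "nat set" assume "X \<noteq> Y"
    have "branch X - branch Y = branch X - branch X \<inter> branch Y"
      by blast
    then have inf: "infinite (branch X - branch Y)"
      using infinite_branch finite_branch_Int[OF \<open>X \<noteq> Y\<close>] by (metis Diff_infinite_finite)
    show "3/4 \<le> quotient_norm (range embed) (indicator_class (V X) - indicator_class (V Y))"
      unfolding quotient_norm_def
    proof (rule cINF_greatest)
      fix z assume "z \<in> range embed"
      then show "3/4 \<le> norm (indicator_class (V X) - indicator_class (V Y) - z)"
        using sub disj by (intro dist_range_embed[OF x inf]) auto
    qed simp
  qed
qed

text \<open>One coset within \<open>1/4\<close> of two different \<open>v X\<close> would bring
  these closer than \<open>3/4\<close>, so a dense set needs a separate coset for each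
  \<open>X\<close>.\<close>

lemma card_dense_ge:
  assumes "infinite (UNIV :: 'i set)" "dense_in_quotient (range embed) D"
  shows "|UNIV :: nat set set| \<le>o |D|"
proof -
  let ?Z = "range embed"
  obtain v :: "nat set \<Rightarrow> linfty_mod_c0"
    where v: "\<And>X Y. X \<noteq> Y \<Longrightarrow> 3/4 \<le> quotient_norm ?Z (v X - v Y)"
    using separated_classes[OF assms(1)] by blast
  have "\<exists>y. coset ?Z y \<in> D \<and> quotient_norm ?Z (v X - y) < 1/4" for X
    using assms(2) unfolding dense_in_quotient_def by (metis zero_less_divide_1_iff zero_less_numeral)
  then obtain y where y: "\<And>X. coset ?Z (y X) \<in> D" "\<And>X. quotient_norm ?Z (v X - y X) < 1/4"
    by metis
  have "inj (\<lambda>X. coset ?Z (y X))"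
  proof (rule injI, rule ccontr)
    fix X Y assume eq: "coset ?Z (y X) = coset ?Z (y Y)" and "X \<noteq> Y"
    have "y X \<in> coset ?Z (y X)"
      unfolding coset_def
      by (rule image_eqI[OF _ subspace_0[OF subspace_range_embed]]) simp
    then have "y X \<in> coset ?Z (y Y)"
      by (simp only: eq)
    then obtain z where "y X = y Y + z" "z \<in> ?Z"
      unfolding coset_def by (rule imageE)
    then have "y X - y Y \<in> ?Z"
      by simp
    then have "quotient_norm ?Z (v X - v Y) = quotient_norm ?Z ((v X - y X) - (v Y - y Y))"
      by (intro quotient_norm_cong[OF subspace_range_embed]) (simp add: algebra_simps)
    also have "\<dots> \<le> quotient_norm ?Z (v X - y X) + quotient_norm ?Z ((- 1) *\<^sub>R (v Y - y Y))"
      using quotient_norm_triangle[OF subspace_range_embed, of "v X - y X" "- (v Y - y Y)"]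
      by (simp add: algebra_simps)
    also have "\<dots> < 1/2"
      unfolding quotient_norm_scaleR[OF subspace_range_embed] using y(2)[of X] y(2)[of Y] by simp
    finally show False
      using v[OF \<open>X \<noteq> Y\<close>] by simp
  qed
  then show ?thesis
    using y(1) by (auto simp: card_of_ordLeq[symmetric])
qed

end

text \<open>A bounded sequence is determined by the rationals below each of its entries, a subset of
  a countable set.\<close>

lemma card_linfty_mod_c0: "|UNIV :: linfty_mod_c0 set| \<le>o |UNIV :: nat set set|"
proof -
  define cut :: "linfty \<Rightarrow> nat set" where
    "cut x = to_nat ` {(n :: nat, q :: rat). of_rat q < apply_bcontfun x n}" for x
  have "inj cut"
  proof (rule injI)
    fix x y assume eq: "cut x = cut y"
    have "\<not> apply_bcontfun x n < apply_bcontfun y n" if "cut x = cut y" for x y n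
    proof
      assume "apply_bcontfun x n < apply_bcontfun y n"
      then obtain q where "apply_bcontfun x n < of_rat q" "of_rat q < apply_bcontfun y n"
        using of_rat_dense by blast
      then have "to_nat (n, q) \<in> cut y" "to_nat (n, q) \<notin> cut x"
        unfolding cut_def by (auto simp: image_iff)
      then show False
        using that by simp
    qed
    from this[OF eq] this[OF eq[symmetric]] show "x = y"
      by (intro bcontfun_eqI) (meson linorder_less_linear)
  qed
  then have 1: "|UNIV :: linfty set| \<le>o |UNIV :: nat set set|"
    by (auto simp: card_of_ordLeq[symmetric])
  have "range abs_linfty_mod_c0 = UNIV"
    using Quotient_abs_rep[OF Quotient_linfty_mod_c0] by (metis surj_def)
  then have "|UNIV :: linfty_mod_c0 set| \<le>o |UNIV :: linfty set|"
    by (metis card_of_image)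
  then show ?thesis
    using 1 by (rule ordLeq_transitive)
qed

text \<open>The density lies between the number of separated classes and the size of the whole
  space; hence any two such copies have the same codimension.\<close>

lemma (in ad_family) dens_quotient_range_embed:
  assumes "infinite (UNIV :: 'i set)"
  shows "dens_quotient (range embed) =o |UNIV :: nat set set|"
proof -
  let ?Z = "range embed"
  obtain D where D: "dense_in_quotient ?Z D" "dens_quotient ?Z = |D|"
      "\<And>C. dense_in_quotient ?Z C \<Longrightarrow> |D| \<le>o |C|"
    unfolding dens_quotient_def
    using least_card_attained[of "dense_in_quotient ?Z", OF dense_in_quotient_range[OF subspace_range_embed]]
    by blast
  have "|D| \<le>o |range (coset ?Z)|"
    by (rule D(3)[OF dense_in_quotient_range[OF subspace_range_embed]])
  also have "|range (coset ?Z)| \<le>o |UNIV :: linfty_mod_c0 set|"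
    by (rule card_of_image)
  also have "|UNIV :: linfty_mod_c0 set| \<le>o |UNIV :: nat set set|"
    by (rule card_linfty_mod_c0)
  finally show ?thesis
    using card_dense_ge[OF assms D(1)] by (simp add: D(2) ordIso_iff_ordLeq)
qed

section \<open>Operators on \<open>\<ell>\<^sub>\<infinity>/c\<^sub>0\<close>\<close>

text \<open>Disjointness keeps every signed sum of the indicators in the unit ball. The finitely
  many sign patterns are controlled simultaneously, and at each \<open>n\<close> the pattern
  matching the entries gives the sum of absolute values. The extra 1 is slack, since an eventual
  bound needs a number strictly above the norm.\<close>

lemma sum_norm_image_indicator_class_le:
  fixes T :: "linfty_mod_c0 \<Rightarrow> linfty_mod_c0"
  assumes T: "bounded_linear T" and "finite I" "disjoint_family_on S I"
    and rep: "\<And>i. T (indicator_class (S i)) = abs_linfty_mod_c0 (y i)"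
  shows "\<forall>\<^sub>F n in sequentially. (\<Sum>i\<in>I. \<bar>apply_bcontfun (y i) n\<bar>) \<le> onorm T + 1"
proof -
  define \<sigma> :: "'a set \<Rightarrow> 'a \<Rightarrow> real" where "\<sigma> J i = (if i \<in> J then 1 else - 1)" for J i
  have "\<forall>\<^sub>F n in sequentially. \<forall>J\<in>Pow I. \<bar>\<Sum>i\<in>I. \<sigma> J i * apply_bcontfun (y i) n\<bar> < onorm T + 1"
  proof (rule eventually_ball_finite, goal_cases)
    case 2
    show ?case
    proof
      fix J
      have "\<bar>\<Sum>i\<in>I. \<sigma> J i * indicator (S i) n\<bar> \<le> 1" for n
      proof (cases "\<exists>i\<in>I. n \<in> S i")
        case True
        then obtain i where i: "i \<in> I" "n \<in> S i"
          by blast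
        then have "(\<Sum>j\<in>I. \<sigma> J j * indicator (S j) n) = (\<Sum>j\<in>I. if i = j then \<sigma> J i else 0)"
          using assms(3) by (intro sum.cong) (auto simp: disjoint_family_on_def indicator_def)
        then show ?thesis
          using i(1) assms(2) by (simp add: \<sigma>_def)
      next
        case False
        then have "(\<Sum>j\<in>I. \<sigma> J j * indicator (S j) n) = 0"
          by (intro sum.neutral) auto
        then show ?thesis
          by simp
      qed
      then have "norm (\<Sum>i\<in>I. \<sigma> J i *\<^sub>R indicator_class (S i)) \<le> 1"
        by (intro norm_sum_indicator_class_le) auto
      then have "norm (T (\<Sum>i\<in>I. \<sigma> J i *\<^sub>R indicator_class (S i))) \<le> onorm T * 1"
        by (intro order_trans[OF onorm[OF T]] mult_left_mono onorm_pos_le T)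
      moreover have "T (\<Sum>i\<in>I. \<sigma> J i *\<^sub>R indicator_class (S i)) =
          abs_linfty_mod_c0 (\<Sum>i\<in>I. \<sigma> J i *\<^sub>R y i)"
        using bounded_linear.linear[OF T]
        by (simp add: linear_sum linear_scale rep linear_abs_linfty_mod_c0)
      ultimately have "norm (abs_linfty_mod_c0 (\<Sum>i\<in>I. \<sigma> J i *\<^sub>R y i)) < onorm T + 1"
        by simp
      from eventually_less_norm_abs_linfty_mod_c0[OF this]
      show "\<forall>\<^sub>F n in sequentially. \<bar>\<Sum>i\<in>I. \<sigma> J i * apply_bcontfun (y i) n\<bar> < onorm T + 1"
        by (simp add: apply_bcontfun_sum)
    qed
  qed (use assms(2) in simp)
  then show ?thesis
  proof eventually_elim
    case (elim n)
    have "(\<Sum>i\<in>I. \<bar>apply_bcontfun (y i) n\<bar>) =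
        (\<Sum>i\<in>I. \<sigma> {i \<in> I. 0 \<le> apply_bcontfun (y i) n} i * apply_bcontfun (y i) n)"
      by (intro sum.cong) (auto simp: \<sigma>_def)
    then show ?case
      using bspec[OF elim, of "{i \<in> I. 0 \<le> apply_bcontfun (y i) n}"] by auto
  qed
qed

text \<open>Bridges the gap between \<open>isomorphism_between\<close>, which provides continuity,
  and the operator norm used in the contradiction.\<close>

lemma bounded_linear_of_continuous:
  fixes f :: "'a::real_normed_vector \<Rightarrow> 'b::real_normed_vector"
  assumes "linear f" "continuous_on UNIV f"
  shows "bounded_linear f"
proof -
  have "isCont f 0"
    using assms(2) by (simp add: continuous_on_eq_continuous_at)
  then obtain d where d: "d > 0" "\<And>x. norm x < d \<Longrightarrow> norm (f x) < 1"
    unfolding continuous_at_eps_delta using linear_0[OF assms(1)]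
    by (metis dist_0_norm dist_commute zero_less_one)
  show ?thesis
  proof (rule bounded_linear_intro)
    show "norm (f x) \<le> norm x * (2 / d)" for x
    proof (cases "x = 0")
      case False
      have "norm (f ((d / (2 * norm x)) *\<^sub>R x)) < 1"
        using False d(1) by (intro d(2)) simp
      then show ?thesis
        using False d(1) by (simp add: linear_scale[OF assms(1)] field_simps)
    qed (simp add: linear_0[OF assms(1)])
  qed (simp_all add: linear_add[OF assms(1)] linear_scale[OF assms(1)])
qed

section \<open>The operator between the two copies does not extend\<close>

lemma null_of_abs_eq_0:
  assumes "abs_linfty_mod_c0 x = 0"
  shows "apply_bcontfun x \<longlonglongrightarrow> 0"
proof (rule tendstoI)
  fix e :: real assume "e > 0"
  then show "\<forall>\<^sub>F n in sequentially. dist (apply_bcontfun x n) 0 < e"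
    using eventually_less_norm_abs_linfty_mod_c0[of x e] assms by (simp add: dist_real_def)
qed

text \<open>Representing sequences of \<open>T\<close> satisfy \<open>branch_operator\<close>, in
  which \<open>UNIV\<close> is not positive, although it hits all of the infinitely many
  members.\<close>

lemma (in mad_family) no_extension_from_branches:
  assumes "\<And>\<xi>. infinite (A \<xi>)" "infinite (UNIV :: 'i set)" "inj b" "bounded_linear T"
    and T: "\<And>\<xi>. T (indicator_class (branch (b \<xi>))) = indicator_class (A \<xi>)"
  shows False
proof -
  \<comment> \<open>Representatives are arbitrary, so additivity and the values at branches hold
    only up to null sequences.\<close>
  define y where "y S = rep_linfty_mod_c0 (T (indicator_class S))" for S
  have y: "T (indicator_class S) = abs_linfty_mod_c0 (y S)" for S
    unfolding y_def using Quotient_abs_rep[OF Quotient_linfty_mod_c0] by metis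
  note linear_T = bounded_linear.linear[OF assms(4)]
  interpret branch_operator A b "\<lambda>S. apply_bcontfun (y S)" "onorm T + 1"
  proof
    show "inj b"
      by fact
    show "\<forall>\<^sub>F n in sequentially. (\<Sum>i<k. \<bar>apply_bcontfun (y (S i)) n\<bar>) \<le> onorm T + 1"
      if "disjoint_family_on S {..<k}" for S and k :: nat
      using assms(4) finite_lessThan that y by (rule sum_norm_image_indicator_class_le)
    show "(\<lambda>n. apply_bcontfun (y (S \<union> S')) n - apply_bcontfun (y S) n - apply_bcontfun (y S') n) \<longlonglongrightarrow> 0"
      if "S \<inter> S' = {}" for S S'
    proof -
      have "abs_linfty_mod_c0 (y (S \<union> S') - y S - y S') = 0"
        by (simp add: linear_diff[OF linear_abs_linfty_mod_c0] y[symmetric]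
            indicator_class_Un[OF that] linear_add[OF linear_T])
      from null_of_abs_eq_0[OF this] show ?thesis
        by simp
    qed
    show "apply_bcontfun (y S) \<longlonglongrightarrow> 0" if "finite S" for S
      by (rule null_of_abs_eq_0)
        (simp add: y[symmetric] indicator_class_finite[OF that] linear_0[OF linear_T])
    show "(\<lambda>n. apply_bcontfun (y (branch (b \<xi>))) n - indicator (A \<xi>) n) \<longlonglongrightarrow> 0" for \<xi>
    proof -
      have "abs_linfty_mod_c0 (y (branch (b \<xi>)) - Bcontfun (indicator (A \<xi>))) = 0"
        by (simp add: linear_diff[OF linear_abs_linfty_mod_c0] y[symmetric] T
            flip: indicator_class_def)
      from null_of_abs_eq_0[OF this] show ?thesis
        by (simp add: apply_Bcontfun_indicator)
    qed
  qed
  have "positive UNIV"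
    using assms(1,2) by (simp add: positive_def hits_def)
  then show False
    using not_positive_UNIV by blast
qed

theorem theorem1p2:
  assumes "almost_disjointness_number =o aleph1"
  shows "\<not> automorphic TYPE(linfty_mod_c0) TYPE(omega1 c0) \<and>
         \<not> extensible TYPE(linfty_mod_c0) TYPE(omega1 c0)"
proof -
  obtain \<M> where \<M>: "infinite \<M>" "maximal_almost_disjoint \<M>" "almost_disjointness_number = |\<M>|"
    using least_card_attained[of "\<lambda>\<A>. infinite \<A> \<and> maximal_almost_disjoint \<A>"]
      infinite_maximal_almost_disjoint_exists unfolding almost_disjointness_number_def by metis
  have "|UNIV :: omega1 set| =o |\<M>|"
    using card_of_omega1 assms \<M>(3) by (metis ordIso_symmetric ordIso_transitive)
  then obtain a :: "omega1 \<Rightarrow> nat set" where a: "bij_betw a UNIV \<M>"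
    by (auto simp: card_of_ordIso[symmetric])
  have a_mem: "a \<xi> \<in> \<M>" for \<xi>
    using a by (auto simp: bij_betw_def)
  have ad: "almost_disjoint \<M>"
    using \<M>(2) by (simp add: maximal_almost_disjoint_def)
  have inf_omega1: "infinite (UNIV :: omega1 set)"
    using \<M>(1) bij_betw_finite[OF a] by simp
  have a_inf: "infinite (a \<xi>)" for \<xi>
    using ad a_mem by (auto simp: almost_disjoint_def)
  have a_disj: "finite (a \<xi> \<inter> a \<eta>)" if "\<xi> \<noteq> \<eta>" for \<xi> \<eta>
    using ad a_mem that a by (auto simp: almost_disjoint_def pairwise_def bij_betw_def inj_eq)
  interpret A: mad_family a
  proof
    show "\<exists>\<xi>. infinite (C \<inter> a \<xi>)" if C: "infinite C" for C
    proof (rule ccontr)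
      assume "\<nexists>\<xi>. infinite (C \<inter> a \<xi>)"
      then have fin: "finite (C \<inter> M)" if "M \<in> \<M>" for M
        using that a by (auto simp: bij_betw_def)
      \<comment> \<open>Maximality now forces \<open>C\<close> into the family, but the intersection
        of \<open>C\<close> with itself is infinite.\<close>
      then have "almost_disjoint (insert C \<M>)"
        using ad C by (auto simp: almost_disjoint_def pairwise_insert Int_commute)
      then have "C \<in> \<M>"
        using \<M>(2) unfolding maximal_almost_disjoint_def by blast
      then show False
        using fin[of C] C by simp
    qed
  qed (rule a_disj)
  interpret A: ad_family a
    by unfold_locales (rule a_inf, rule a_disj)
  \<comment> \<open>\<open>aleph1\<close> is a wellorder on sets of naturals, so the representation
    map already supplies distinct branches indexed by \<open>omega1\<close>.\<close>
  have inj_Rep: "inj Rep_omega1"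
    by (simp add: inj_def Rep_omega1_inject)
  interpret B: ad_family "\<lambda>\<xi>. branch (Rep_omega1 \<xi>)"
    by unfold_locales (simp_all add: infinite_branch finite_branch_Int Rep_omega1_inject)
  define T where "T = A.embed \<circ> inv B.embed"
  \<comment> \<open>Excludes every bounded extension, invertible or not, and thus serves both
    claims.\<close>
  have no_ext: False if "bounded_linear T'" "\<forall>x\<in>range B.embed. T' x = T x" for T'
  proof (rule A.no_extension_from_branches[OF a_inf inf_omega1 inj_Rep that(1)])
    fix \<xi>
    obtain f where f: "B.embed f = indicator_class (branch (Rep_omega1 \<xi>))"
        "apply_c0 f = (\<lambda>\<eta>. of_bool (\<eta> = \<xi>))"
      by (rule B.embed_unit)
    obtain g where g: "A.embed g = indicator_class (a \<xi>)" "apply_c0 g = (\<lambda>\<eta>. of_bool (\<eta> = \<xi>))"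
      by (rule A.embed_unit)
    have "f = g"
      using f(2) g(2) by (simp add: apply_c0_inject[symmetric])
    then show "T' (indicator_class (branch (Rep_omega1 \<xi>))) = indicator_class (a \<xi>)"
      using that(2) f(1) g(1) by (simp add: T_def B.inj_embed flip: f(1))
  qed
  have lin: "linear_on_subspace (range B.embed) T"
    using B.linear_on_inv_embed unfolding linear_on_subspace_def T_def
    by (simp add: linear_add[OF A.linear_embed] linear_scale[OF A.linear_embed])
  have "homeomorphism UNIV (range A.embed) A.embed (inv A.embed)"
    using A.homeomorphism_inv_embed by (rule homeomorphism_symD)
  from homeomorphism_compose[OF B.homeomorphism_inv_embed this]
  have iso: "isomorphism_between (range B.embed) (range A.embed) T"
    using lin unfolding isomorphism_between_def T_def by blast
  have "operator_on (range B.embed) T"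
    unfolding operator_on_def
    by (intro conjI lin exI[of _ 1]) (auto simp: T_def A.norm_embed B.norm_embed B.inj_embed)
  then have "\<not> extensible TYPE(linfty_mod_c0) TYPE(omega1 c0)"
    using no_ext B.isomorphic_range_embed unfolding extensible_def by blast
  moreover have "\<not> automorphic TYPE(linfty_mod_c0) TYPE(omega1 c0)"
  proof
    assume "automorphic TYPE(linfty_mod_c0) TYPE(omega1 c0)"
    moreover have "dens_quotient (range B.embed) =o dens_quotient (range A.embed)"
      using A.dens_quotient_range_embed[OF inf_omega1] B.dens_quotient_range_embed[OF inf_omega1]
      by (metis ordIso_symmetric ordIso_transitive)
    ultimately obtain T' where T': "isomorphism_between UNIV UNIV T'" "\<forall>x\<in>range B.embed. T' x = T x"
      using iso A.isomorphic_range_embed B.isomorphic_range_embed unfolding automorphic_def by blast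
    have "linear T'"
      using T'(1) unfolding isomorphism_between_def linear_on_subspace_def
      by (intro linearI) auto
    moreover have "continuous_on UNIV T'"
      using T'(1) unfolding isomorphism_between_def homeomorphism_def by blast
    ultimately have "bounded_linear T'"
      by (rule bounded_linear_of_continuous)
    then show False
      using T'(2) no_ext by blast
  qed
  ultimately show ?thesis
    by blast
qed

end
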